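(* Let $\mathcal{M}$ be an irreducible weight module over the twisted Schrödinger-Virasoro Lie algebra $\mathscr{L}$. Assume that there exists $\lambda\in\mathbb{C}$ such that $0<\dim\mathcal{M}_\lambda<\infty$. Then $\mathcal{M}$ is a Harish-Chandra module.
   Context: The twisted Schrödinger-Virasoro Lie algebra $\mathscr{L}$ is the infinite-dimensional complex Lie algebra with $\mathbb{C}$-basis $\{L_n,Y_m,M_p\mid m,n,p\in\mathbb{Z}\}$ and relations, for all $m,m',n,p\in\mathbb{Z}$: $[L_n,L_p]=(p-n)L_{n+p}$, $[L_n,Y_m]=(m-\frac{n}{2})Y_{n+m}$, $[L_n,M_p]=pM_{n+p}$, $[Y_m,Y_{m'}]=(m'-m)M_{m+m'}$, $[Y_m,M_p]=[M_n,M_p]=0$. A weight module over $\mathscr{L}$ is a module on which the Cartan subalgebra $\mathfrak{H}=\mathrm{Span}_{\mathbb{C}}\{L_0,M_0\}$ acts diagonalizably. If $\mathcal{M}$ is an irreducible weight $\mathscr{L}$-module, then $M_0$ acts as a scalar and $\mathcal{M}=\bigoplus_{\lambda\in\mathbb{C}}\mathcal{M}_\lambda$, where $\mathcal{M}_\lambda=\{v\in\mathcal{M}\mid L_0v=\lambda v\}$ is the weight space of weight $\lambda$. A Harish-Chandra module is an irreducible weight $\mathscr{L}$-module all of whose weight spaces $\mathcal{M}_\lambda$ are finite-dimensional. *)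

theory Defs
  imports Complex_Main "HOL-Library.Poly_Mapping"
begin

section \<open>Lie algebras and their modules\<close>

text \<open>The underlying vector space of a Lie algebra or of a module is a whole type,
  as in the library locale \<^locale>\<open>vector_space\<close>.\<close>

locale lie_algebra = vector_space scale
  for scale :: "'k::field \<Rightarrow> 'g::ab_group_add \<Rightarrow> 'g" +
  fixes bracket :: "'g \<Rightarrow> 'g \<Rightarrow> 'g"
  assumes bracket_linear_left: "Vector_Spaces.linear scale scale (\<lambda>x. bracket x y)"
    and bracket_linear_right: "Vector_Spaces.linear scale scale (\<lambda>y. bracket x y)"
    and bracket_self: "bracket x x = 0"
    and jacobi: "bracket x (bracket y z) + bracket y (bracket z x) + bracket z (bracket x y) = 0"

locale lie_module = lie_algebra scale bracket + V: vector_space vscale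
  for scale :: "'k::field \<Rightarrow> 'g::ab_group_add \<Rightarrow> 'g"
    and bracket :: "'g \<Rightarrow> 'g \<Rightarrow> 'g"
    and vscale :: "'k \<Rightarrow> 'v::ab_group_add \<Rightarrow> 'v" +
  fixes act :: "'g \<Rightarrow> 'v \<Rightarrow> 'v"
  assumes act_linear_left: "Vector_Spaces.linear scale vscale (\<lambda>x. act x v)"
    and act_linear_right: "Vector_Spaces.linear vscale vscale (\<lambda>v. act x v)"
    and act_bracket: "act (bracket x y) v = act x (act y v) - act y (act x v)"
begin

definition submodule :: "'v set \<Rightarrow> bool" where
  "submodule W \<longleftrightarrow> V.subspace W \<and> (\<forall>x. \<forall>w\<in>W. act x w \<in> W)"

definition irreducible :: bool where
  "irreducible \<longleftrightarrow> (UNIV :: 'v set) \<noteq> {0} \<and> (\<forall>W. submodule W \<longrightarrow> W = {0} \<or> W = UNIV)"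

text \<open>For a family of operators, diagonalizability means simultaneous diagonalizability:
  there is a basis of common eigenvectors.\<close>

definition acts_diagonalizably :: "'g set \<Rightarrow> bool" where
  "acts_diagonalizably H \<longleftrightarrow>
    (\<exists>B. V.independent B \<and> V.span B = UNIV \<and> (\<forall>b\<in>B. \<forall>h\<in>H. \<exists>c. act h b = vscale c b))"

definition finite_dimensional :: "'v set \<Rightarrow> bool" where
  "finite_dimensional W \<longleftrightarrow> (\<exists>B. finite B \<and> V.span B = W)"

end


section \<open>The twisted Schroedinger-Virasoro Lie algebra\<close>

datatype tsv_basis = L int | Y int | M int

text \<open>The complex vector space with basis \<^typ>\<open>tsv_basis\<close>: finitely supported
  coefficient functions.\<close>

type_synonym tsv = "tsv_basis \<Rightarrow>\<^sub>0 complex"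

definition tsv_scale :: "complex \<Rightarrow> tsv \<Rightarrow> tsv" where
  "tsv_scale c x = Poly_Mapping.map ((*) c) x"

definition basis_vec :: "tsv_basis \<Rightarrow> tsv" where
  "basis_vec b = Poly_Mapping.single b 1"

text \<open>The equations for \<open>[Y, L]\<close>, \<open>[M, L]\<close> and \<open>[M, Y]\<close> are the given relations
  read through antisymmetry.\<close>

fun basis_bracket :: "tsv_basis \<Rightarrow> tsv_basis \<Rightarrow> tsv" where
  "basis_bracket (L n) (L p) = tsv_scale (of_int (p - n)) (basis_vec (L (n + p)))"
| "basis_bracket (L n) (Y m) = tsv_scale (of_int m - of_int n / 2) (basis_vec (Y (n + m)))"
| "basis_bracket (L n) (M p) = tsv_scale (of_int p) (basis_vec (M (n + p)))"
| "basis_bracket (Y m) (Y m') = tsv_scale (of_int (m' - m)) (basis_vec (M (m + m')))"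
| "basis_bracket (Y m) (M p) = 0"
| "basis_bracket (M n) (M p) = 0"
| "basis_bracket (Y m) (L n) = - tsv_scale (of_int m - of_int n / 2) (basis_vec (Y (n + m)))"
| "basis_bracket (M p) (L n) = - tsv_scale (of_int p) (basis_vec (M (n + p)))"
| "basis_bracket (M p) (Y m) = 0"

definition linear_extension :: "(tsv_basis \<Rightarrow> tsv) \<Rightarrow> tsv \<Rightarrow> tsv" where
  "linear_extension f x =
    (\<Sum>b\<in>Poly_Mapping.keys x. tsv_scale (Poly_Mapping.lookup x b) (f b))"

definition tsv_bracket :: "tsv \<Rightarrow> tsv \<Rightarrow> tsv" where
  "tsv_bracket x y = linear_extension (\<lambda>a. linear_extension (basis_bracket a) y) x"

lemma lookup_tsv_scale [simp]:
  "Poly_Mapping.lookup (tsv_scale c x) b = c * Poly_Mapping.lookup x b"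
  by (simp add: tsv_scale_def Poly_Mapping.map.rep_eq when_def)

interpretation tsv: vector_space tsv_scale
  by unfold_locales (auto intro!: poly_mapping_eqI simp: lookup_add algebra_simps)

interpretation tsv_pair: vector_space_pair tsv_scale tsv_scale ..

lemma linearI_tsv:
  assumes "\<And>x y. f (x + y) = f x + f y" "\<And>c x. f (tsv_scale c x) = tsv_scale c (f x)"
  shows "Vector_Spaces.linear tsv_scale tsv_scale f"
  by unfold_locales (use assms in auto)

lemma linear_extension_superset:
  assumes "finite A" "Poly_Mapping.keys x \<subseteq> A"
  shows "linear_extension f x = (\<Sum>b\<in>A. tsv_scale (Poly_Mapping.lookup x b) (f b))"
  unfolding linear_extension_def
  by (rule sum.mono_neutral_left) (use assms in \<open>auto simp: in_keys_iff\<close>)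

lemma linear_linear_extension:
  "Vector_Spaces.linear tsv_scale tsv_scale (linear_extension f)"
proof (rule linearI_tsv)
  fix x y :: tsv and c :: complex
  let ?A = "Poly_Mapping.keys x \<union> Poly_Mapping.keys y \<union> Poly_Mapping.keys (x + y)"
  have "linear_extension f z = (\<Sum>b\<in>?A. tsv_scale (Poly_Mapping.lookup z b) (f b))"
    if "z \<in> {x, y, x + y}" for z
    by (rule linear_extension_superset) (use that in auto)
  then show "linear_extension f (x + y) = linear_extension f x + linear_extension f y"
    by (simp add: lookup_add tsv.scale_left_distrib sum.distrib)
  have "linear_extension f (tsv_scale c x)
      = (\<Sum>b\<in>Poly_Mapping.keys x. tsv_scale (Poly_Mapping.lookup (tsv_scale c x) b) (f b))"
    by (rule linear_extension_superset) (auto simp: in_keys_iff)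
  then show "linear_extension f (tsv_scale c x) = tsv_scale c (linear_extension f x)"
    by (simp add: linear_extension_def tsv.scale_sum_right)
qed

lemma linear_extension_basis_vec [simp]: "linear_extension f (basis_vec b) = f b"
  by (simp add: linear_extension_def basis_vec_def)

lemma tsv_expand:
  "x = (\<Sum>b\<in>Poly_Mapping.keys x. tsv_scale (Poly_Mapping.lookup x b) (basis_vec b))"
proof (rule poly_mapping_eqI)
  fix k
  show "Poly_Mapping.lookup x k = Poly_Mapping.lookup
      (\<Sum>b\<in>Poly_Mapping.keys x. tsv_scale (Poly_Mapping.lookup x b) (basis_vec b)) k"
    by (simp add: lookup_sum basis_vec_def lookup_single when_def in_keys_iff
        flip: if_distrib [where f = "(*) _"] cong: if_cong)
       (auto simp: in_keys_iff if_distrib cong: if_cong)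
qed

lemma tsv_linear_eqI:
  assumes "Vector_Spaces.linear tsv_scale tsv_scale f" "Vector_Spaces.linear tsv_scale tsv_scale g"
    and "\<And>b. f (basis_vec b) = g (basis_vec b)"
  shows "f x = g x"
proof -
  have "x \<in> tsv.span (range basis_vec)"
    by (subst tsv_expand) (intro tsv.span_sum tsv.span_scale tsv.span_base, auto)
  then show ?thesis
    using tsv_pair.linear_eq_on [OF assms(1,2)] assms(3) by blast
qed

lemma tsv_bracket_basis:
  "tsv_bracket (basis_vec a) (basis_vec b) = basis_bracket a b"
  by (simp add: tsv_bracket_def)

lemma tsv_bracket_linear_left: "Vector_Spaces.linear tsv_scale tsv_scale (\<lambda>x. tsv_bracket x y)"
  unfolding tsv_bracket_def by (rule linear_linear_extension)

lemma tsv_bracket_linear_right: "Vector_Spaces.linear tsv_scale tsv_scale (\<lambda>y. tsv_bracket x y)"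
  unfolding tsv_bracket_def linear_extension_def [of _ x]
  by (intro tsv_pair.linear_compose_sum tsv_pair.linear_compose_scale_right
      ballI linear_linear_extension)

lemmas tsv_bracket_linear_simps =
  tsv_pair.linear_add [OF tsv_bracket_linear_left] tsv_pair.linear_add [OF tsv_bracket_linear_right]
  tsv_pair.linear_scale [OF tsv_bracket_linear_left] tsv_pair.linear_scale [OF tsv_bracket_linear_right]
  tsv_pair.linear_neg [OF tsv_bracket_linear_left] tsv_pair.linear_neg [OF tsv_bracket_linear_right]
  tsv_pair.linear_0 [OF tsv_bracket_linear_left] tsv_pair.linear_0 [OF tsv_bracket_linear_right]

lemma basis_bracket_antisym: "basis_bracket a b = - basis_bracket b a"
  by (cases a; cases b) (auto intro!: poly_mapping_eqI simp: basis_vec_def lookup_single when_def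
      algebra_simps)

lemma tsv_bracket_antisym: "tsv_bracket x y = - tsv_bracket y x"
proof -
  have 1: "tsv_bracket x (basis_vec b) = - tsv_bracket (basis_vec b) x" for x b
    by (rule tsv_linear_eqI [where f = "\<lambda>x. tsv_bracket x (basis_vec b)"
          and g = "\<lambda>x. - tsv_bracket (basis_vec b) x"])
       (auto intro!: tsv_bracket_linear_left tsv_pair.linear_compose_neg tsv_bracket_linear_right
          simp: tsv_bracket_basis basis_bracket_antisym [of _ b])
  show ?thesis
    by (rule tsv_linear_eqI [where f = "\<lambda>y. tsv_bracket x y" and g = "\<lambda>y. - tsv_bracket y x"])
       (auto intro!: tsv_bracket_linear_left tsv_pair.linear_compose_neg tsv_bracket_linear_right
          simp: 1)
qed

definition tsv_jac :: "tsv \<Rightarrow> tsv \<Rightarrow> tsv \<Rightarrow> tsv" where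
  "tsv_jac x y z = tsv_bracket x (tsv_bracket y z) + tsv_bracket y (tsv_bracket z x)
    + tsv_bracket z (tsv_bracket x y)"

lemma tsv_jac_linear:
  "Vector_Spaces.linear tsv_scale tsv_scale (\<lambda>x. tsv_jac x y z)"
  by (rule linearI_tsv)
     (simp_all add: tsv_jac_def tsv_bracket_linear_simps tsv.scale_right_distrib)

lemma tsv_jac_cycle: "tsv_jac x y z = tsv_jac y z x"
  by (simp add: tsv_jac_def)

lemma lookup_basis_vec: "Poly_Mapping.lookup (basis_vec a) k = (if a = k then 1 else 0)"
  by (simp add: basis_vec_def lookup_single when_def)

lemma tsv_jac_basis: "tsv_jac (basis_vec a) (basis_vec b) (basis_vec c) = 0"
proof (rule poly_mapping_eqI)
  fix k
  show "Poly_Mapping.lookup (tsv_jac (basis_vec a) (basis_vec b) (basis_vec c)) k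
      = Poly_Mapping.lookup 0 k"
    by (cases a; cases b; cases c)
       (simp_all add: tsv_jac_def tsv_bracket_basis tsv_bracket_linear_simps lookup_add
         lookup_minus lookup_basis_vec ac_simps, simp_all add: field_simps)
qed

lemma tsv_jac_eq_0: "tsv_jac x y z = 0"
proof -
  have lin: "f x = 0"
    if "Vector_Spaces.linear tsv_scale tsv_scale f" "\<And>b. f (basis_vec b) = 0" for f x
    by (rule tsv_linear_eqI [where g = "\<lambda>_. 0"]) (use that in \<open>auto intro: tsv_pair.linear_zero\<close>)
  have 1: "tsv_jac x (basis_vec b) (basis_vec c) = 0" for x b c
    by (rule lin [OF tsv_jac_linear]) (rule tsv_jac_basis)
  have "tsv_jac y (basis_vec c) x = 0" for x y c
    by (rule lin [OF tsv_jac_linear]) (simp add: 1 flip: tsv_jac_cycle [of x])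
  then have "tsv_jac (basis_vec c) x y = 0" for c x y
    by (subst tsv_jac_cycle, subst tsv_jac_cycle)
  then show ?thesis
    by (rule lin [OF tsv_jac_linear])
qed

interpretation tsv: lie_algebra tsv_scale tsv_bracket
proof (intro lie_algebra.intro lie_algebra_axioms.intro tsv.vector_space_axioms)
  fix x y z :: tsv
  show "Vector_Spaces.linear tsv_scale tsv_scale (\<lambda>x. tsv_bracket x y)"
    by (rule tsv_bracket_linear_left)
  show "Vector_Spaces.linear tsv_scale tsv_scale (\<lambda>y. tsv_bracket x y)"
    by (rule tsv_bracket_linear_right)
  have neg0: "u = - u \<Longrightarrow> u = 0" for u :: complex
    by (simp add: complex_eq_iff)
  have "tsv_bracket x x = - tsv_bracket x x"
    by (rule tsv_bracket_antisym)
  then have "Poly_Mapping.lookup (tsv_bracket x x) k = - Poly_Mapping.lookup (tsv_bracket x x) k" for k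
    by (subst lookup_uminus [symmetric]) (rule arg_cong [where f = "\<lambda>u. Poly_Mapping.lookup u k"])
  then have "Poly_Mapping.lookup (tsv_bracket x x) k = 0" for k
    by (rule neg0)
  then show "tsv_bracket x x = 0"
    by (auto intro: poly_mapping_eqI)
  show "tsv_bracket x (tsv_bracket y z) + tsv_bracket y (tsv_bracket z x)
      + tsv_bracket z (tsv_bracket x y) = 0"
    using tsv_jac_eq_0 [of x y z] by (simp add: tsv_jac_def)
qed

definition tsv_cartan :: "tsv set" where
  "tsv_cartan = tsv.span {basis_vec (L 0), basis_vec (M 0)}"


section \<open>Weight modules\<close>

locale tsv_module = lie_module tsv_scale tsv_bracket vscale act
  for vscale :: "complex \<Rightarrow> 'v::ab_group_add \<Rightarrow> 'v" and act :: "tsv \<Rightarrow> 'v \<Rightarrow> 'v"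
begin

definition weight_module :: bool where
  "weight_module \<longleftrightarrow> acts_diagonalizably tsv_cartan"

text \<open>Only \<open>L 0\<close> enters: on an irreducible weight module \<open>M 0\<close> acts as a scalar.\<close>

definition weight_space :: "complex \<Rightarrow> 'v set" where
  "weight_space \<mu> = {v. act (basis_vec (L 0)) v = vscale \<mu> v}"

definition Harish_Chandra :: bool where
  "Harish_Chandra \<longleftrightarrow> irreducible \<and> weight_module \<and> (\<forall>\<mu>. finite_dimensional (weight_space \<mu>))"

end

end

theory Submission
  imports Defs
begin

text \<open>Suppose that some weight space is infinite-dimensional. A nonzero weight vector annihilated by
  all positive (or all negative) operators would generate a module with finite-dimensional weight
  spaces, so there is none. An operator from an infinite-dimensional to a finite-dimensional weight
  space has a large kernel, and finitely many such kernels still meet. Where a finite- and an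
  infinite-dimensional weight space are adjacent, this yields \<open>a \<noteq> 0\<close> such that \<open>L 2 a\<close> is nonzero and
  annihilated by all \<open>Y n\<close> and \<open>M n\<close>; hence these act trivially and only the Witt algebra remains.

  If \<open>0 < dim V_s < \<infinity>\<close> and \<open>dim V_(s+1) = \<infinity>\<close>, some \<open>b \<noteq> 0\<close> in \<open>V_(s+1)\<close> is annihilated by the four
  operators \<open>L (-1)\<close>, \<open>L 1 L (-2)\<close>, \<open>L (-1) L 2 L (-2)\<close> and \<open>L 1 L (-2) L 2 L (-2)\<close> into \<open>V_s\<close>. The
  absence of extremal vectors forces \<open>s = 0\<close> and \<open>L 2 L (-2) b = - b\<close>, and then \<open>b\<close> generates a copy of
  the functions modulo constants, a submodule without weight \<open>0\<close>, against irreducibility. So \<open>V_s\<close> and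
  \<open>V_(s+1)\<close> are both finite-dimensional, and a variant of the argument of Mazorchuk and Zhao for the
  Virasoro algebra shows that two finite-dimensional weight spaces exclude infinite-dimensional ones.\<close>

section \<open>Eigenspaces and finite-dimensional subspaces\<close>

locale complex_vector_space = vector_space scale
  for scale :: "complex \<Rightarrow> 'b::ab_group_add \<Rightarrow> 'b" (infixr "*s" 75)
begin

abbreviation lin :: "('b \<Rightarrow> 'b) \<Rightarrow> bool" where
  "lin \<equiv> Vector_Spaces.linear scale scale"

definition fd :: "'b set \<Rightarrow> bool" where
  "fd W \<longleftrightarrow> (\<exists>B. finite B \<and> span B = W)"

lemma linD:
  assumes "lin f"
  shows "f (u + v) = f u + f v" "f (scale c v) = scale c (f v)" "f 0 = 0" "f (- v) = - f v"
    "f (u - v) = f u - f v" "f (sum g A) = (\<Sum>i\<in>A. f (g i))"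
proof -
  interpret module_hom scale scale f
    using assms by (simp add: Vector_Spaces.linear_def)
  show "f (u + v) = f u + f v" "f (scale c v) = scale c (f v)" "f 0 = 0" "f (- v) = - f v"
    "f (u - v) = f u - f v" "f (sum g A) = (\<Sum>i\<in>A. f (g i))"
    by (simp_all add: add scale zero neg diff sum)
qed

lemma linI:
  assumes "\<And>u v. f (u + v) = f u + f v" "\<And>c v. f (scale c v) = scale c (f v)"
  shows "lin f"
  by unfold_locales (use assms in auto)

lemma span_image_closed:
  assumes "lin f" "\<And>r. r \<in> R \<Longrightarrow> f r \<in> span S" "w \<in> span R"
  shows "f w \<in> span S"
  using assms(3)
proof (induction rule: span_induct_alt)
  case base
  then show ?case by (simp add: linD(3)[OF assms(1)] span_zero)
next
  case (step c x z)
  then show ?case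
    by (simp add: linD[OF assms(1)] span_add span_scale assms(2))
qed

text \<open>Rank-nullity: a spanning set of the kernel together with preimages of a basis of the
  image spans \<open>W\<close>. It is used contrapositively, to obtain infinite-dimensional
  kernels.\<close>

lemma fd_kernel:
  assumes f: "lin f" and W: "subspace W" and Z: "fd Z" "f ` W \<subseteq> Z"
    and K: "fd {w \<in> W. f w = 0}"
  shows "fd W"
proof -
  obtain B where B: "finite B" "span B = {w \<in> W. f w = 0}"
    using K by (auto simp: fd_def)
  obtain D where D: "finite D" "span D = Z"
    using Z by (auto simp: fd_def)
  obtain C where C: "C \<subseteq> f ` W" "independent C" "f ` W \<subseteq> span C"
    using basis_exists by metis
  have "finite C"
    using independent_span_bound[OF D(1) C(2)] C(1) Z(2) D(2) by blast
  obtain g where g: "\<And>c. c \<in> C \<Longrightarrow> g c \<in> W \<and> f (g c) = c"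
  proof -
    have "\<forall>c\<in>C. \<exists>w. w \<in> W \<and> f w = c"
      using C(1) by blast
    then show ?thesis
      using that by (auto dest!: bchoice)
  qed
  have fgC: "f ` g ` C = C"
    using g by force
  interpret vector_space_pair scale scale ..
  have "span (B \<union> g ` C) = W"
  proof
    have "B \<subseteq> W"
      using B(2) span_superset by blast
    then show "span (B \<union> g ` C) \<subseteq> W"
      using g W by (intro span_minimal) auto
    show "W \<subseteq> span (B \<union> g ` C)"
    proof
      fix w assume w: "w \<in> W"
      then have "f w \<in> f ` span (g ` C)"
        using C(3) linear_span_image[OF f, of "g ` C"] fgC by auto
      then obtain u where u: "u \<in> span (g ` C)" "f w = f u" by auto
      have "u \<in> W"
        using u(1) span_minimal[OF _ W, of "g ` C"] g by blast
      then have "w - u \<in> span B"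
        using w u(2) B(2) W by (simp add: linD[OF f] subspace_diff)
      then have "(w - u) + u \<in> span (B \<union> g ` C)"
        using u(1) by (meson span_add span_mono Un_upper1 Un_upper2 subsetD)
      then show "w \<in> span (B \<union> g ` C)" by simp
    qed
  qed
  then show ?thesis
    using B(1) \<open>finite C\<close> unfolding fd_def by (intro exI[of _ "B \<union> g ` C"]) simp
qed

text \<open>Imposing the equations one at a time keeps the solution space infinite-dimensional by
  \<open>fd_kernel\<close>, so it never shrinks to \<open>{0}\<close>.\<close>

lemma common_kernel:
  assumes "finite F" and W: "subspace W" "\<not> fd W"
    and F: "\<And>f. f \<in> F \<Longrightarrow> lin f \<and> (\<exists>Z. fd Z \<and> f ` W \<subseteq> Z)"
  obtains w where "w \<in> W" "w \<noteq> 0" "\<And>f. f \<in> F \<Longrightarrow> f w = 0"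
proof -
  have "subspace {w \<in> W. \<forall>f\<in>F. f w = 0} \<and> \<not> fd {w \<in> W. \<forall>f\<in>F. f w = 0}"
    using assms(1) F
  proof (induction F)
    case empty
    then show ?case using W by simp
  next
    case (insert f F)
    let ?K = "{w \<in> W. \<forall>f\<in>F. f w = 0}"
    have IH: "subspace ?K" "\<not> fd ?K"
      using insert by auto
    obtain Z where Z: "lin f" "fd Z" "f ` W \<subseteq> Z"
      using insert.prems by blast
    have eq: "{w \<in> W. \<forall>f\<in>insert f F. f w = 0} = {w \<in> ?K. f w = 0}"
      by auto
    have "\<not> fd {w \<in> ?K. f w = 0}"
      using fd_kernel[OF Z(1) IH(1) Z(2)] IH(2) Z(3) by blast
    moreover have "subspace {w \<in> ?K. f w = 0}"
      using IH(1) unfolding subspace_def by (auto simp: linD[OF Z(1)])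
    ultimately show ?case
      unfolding eq by blast
  qed
  moreover have "fd {0}"
    unfolding fd_def by (rule exI[of _ "{}"]) simp
  ultimately have "{w \<in> W. \<forall>f\<in>F. f w = 0} \<noteq> {0}" "0 \<in> {w \<in> W. \<forall>f\<in>F. f w = 0}"
    by (auto dest: subspace_0)
  then show ?thesis
    using that by blast
qed

section \<open>Independence of eigenvectors and spanning sets of eigenspaces\<close>

definition eigenspace :: "('b \<Rightarrow> 'b) \<Rightarrow> complex \<Rightarrow> 'b set" where
  "eigenspace f c = {v. f v = scale c v}"

lemma eigenspace_subspace:
  assumes "lin f"
  shows "subspace (eigenspace f c)"
  unfolding subspace_def eigenspace_def by (auto simp: linD[OF assms] scale_right_distrib scale_left_commute)

text \<open>Applying \<open>f - a\<close> to the relation kills the summand at \<open>a\<close> and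
  scales every other one by the nonzero factor \<open>c - a\<close>; the induction hypothesis then
  applies.\<close>

lemma eigenvectors_sum_zero:
  assumes "lin f" "finite F" "\<And>c. c \<in> F \<Longrightarrow> x c \<in> eigenspace f c" "sum x F = 0" "c \<in> F"
  shows "x c = 0"
  using assms(2-)
proof (induction F arbitrary: x c)
  case empty
  then show ?case by simp
next
  case (insert a F)
  have eig: "f (x c) = scale c (x c)" if "c \<in> insert a F" for c
    using insert.prems(1)[OF that] by (simp add: eigenspace_def)
  have "(\<Sum>c\<in>insert a F. scale (c - a) (x c)) = (\<Sum>c\<in>insert a F. f (x c) - scale a (x c))"
    by (rule sum.cong) (simp_all add: eig scale_left_diff_distrib)
  also have "\<dots> = f (sum x (insert a F)) - scale a (sum x (insert a F))"
    by (simp only: sum_subtractf linD(6)[OF assms(1)] scale_sum_right)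
  also have "\<dots> = 0"
    using insert.prems(2) by (simp add: linD[OF assms(1)])
  finally have s: "(\<Sum>c\<in>F. scale (c - a) (x c)) = 0"
    using insert.hyps by simp
  have z: "x c = 0" if "c \<in> F" for c
  proof -
    have "scale (c - a) (x c) = 0"
    proof (rule insert.IH[OF _ s that])
      fix c assume "c \<in> F"
      then show "scale (c - a) (x c) \<in> eigenspace f c"
        using eig[of c] by (simp add: eigenspace_def linD[OF assms(1)] scale_left_commute)
    qed
    then show ?thesis
      using that insert.hyps by auto
  qed
  then have "x a = 0"
    using insert.prems(2) insert.hyps by simp
  then show ?case
    using z insert.prems(3) by auto
qed

text \<open>When a combination of elements of \<open>R\<close> is grouped by eigenvalue,
  independence of eigenvectors leaves only the group belonging to \<open>c\<close>.\<close>

lemma eigenspace_span: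
  assumes f: "lin f" and R: "\<And>r. r \<in> R \<Longrightarrow> \<exists>c. r \<in> eigenspace f c" and U: "span R = UNIV"
  shows "eigenspace f c = span (R \<inter> eigenspace f c)"
proof
  let ?E = "eigenspace f"
  show "span (R \<inter> ?E c) \<subseteq> ?E c"
    by (intro span_minimal eigenspace_subspace f) auto
  show "?E c \<subseteq> span (R \<inter> ?E c)"
  proof
    fix v assume v: "v \<in> ?E c"
    have "\<exists>F x. finite F \<and> (\<forall>d\<in>F. x d \<in> span (R \<inter> ?E d)) \<and> v = sum x F"
    proof -
      have "v \<in> span R" using U by simp
      then show ?thesis
      proof (induction rule: span_induct_alt)
        case base
        show ?case by (rule exI[of _ "{}"]) auto
      next
        case (step k r z)
        then obtain F x where F: "finite F" "\<And>d. d\<in>F \<Longrightarrow> x d \<in> span (R \<inter> ?E d)" "z = sum x F"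
          by blast
        obtain e where e: "r \<in> ?E e" using R step by blast
        have kr: "scale k r \<in> span (R \<inter> ?E e)"
          using e step by (intro span_scale span_base) auto
        define x' where "x' = (\<lambda>d. (if d \<in> F then x d else 0) + (if d = e then scale k r else 0))"
        have "sum x' (insert e F) = (\<Sum>d\<in>insert e F. if d \<in> F then x d else 0)
            + (\<Sum>d\<in>insert e F. if d = e then scale k r else 0)"
          by (simp only: x'_def sum.distrib)
        also have "(\<Sum>d\<in>insert e F. if d \<in> F then x d else 0) = sum x F"
          using F(1) by (subst sum.mono_neutral_right[of "insert e F" F]) auto
        also have "(\<Sum>d\<in>insert e F. if d = e then scale k r else 0) = scale k r"
          using F(1) by simp
        finally have "scale k r + z = sum x' (insert e F)"
          using F(3) by (simp add: add.commute)
        moreover have "\<forall>d\<in>insert e F. x' d \<in> span (R \<inter> ?E d)"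
          using F(2) kr by (auto simp: x'_def span_add span_zero)
        ultimately show ?case
          using F(1) by blast
      qed
    qed
    then obtain F x where F: "finite F" "\<And>d. d\<in>F \<Longrightarrow> x d \<in> span (R \<inter> ?E d)" "v = sum x F"
      by blast
    have sub: "span (R \<inter> ?E d) \<subseteq> ?E d" for d
      by (intro span_minimal eigenspace_subspace f) auto
    \<comment> \<open>The decomposition of \<open>v\<close> with \<open>v\<close> itself subtracted
      at \<open>c\<close>: it sums to zero, so its component at \<open>c\<close> vanishes.\<close>
    define x' where "x' = (\<lambda>d. (if d \<in> F then x d else 0) - (if d = c then v else 0))"
    have "sum x' (insert c F) = (\<Sum>d\<in>insert c F. if d \<in> F then x d else 0)
        - (\<Sum>d\<in>insert c F. if d = c then v else 0)"
      by (simp only: x'_def sum_subtractf)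
    also have "(\<Sum>d\<in>insert c F. if d \<in> F then x d else 0) = sum x F"
      using F(1) by (subst sum.mono_neutral_right[of "insert c F" F]) auto
    also have "(\<Sum>d\<in>insert c F. if d = c then v else 0) = v"
      using F(1) by simp
    finally have s: "sum x' (insert c F) = 0"
      using F(3) by simp
    have "x' c = 0"
    proof (rule eigenvectors_sum_zero[OF f _ _ s])
      fix d
      show "x' d \<in> ?E d"
        using v F(2)[of d] sub[of d] subspace_0[OF eigenspace_subspace[OF f, of d]]
        by (auto simp: x'_def subset_iff subspace_diff subspace_neg eigenspace_subspace[OF f])
    qed (use F(1) in auto)
    then show "v \<in> span (R \<inter> ?E c)"
      using F(2)[of c] by (auto simp: x'_def span_zero split: if_splits)
  qed
qed

lemma eigenspace_unique:
  "v \<in> eigenspace f c \<Longrightarrow> v \<in> eigenspace f d \<Longrightarrow> v \<noteq> 0 \<Longrightarrow> c = d"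
  by (auto simp: eigenspace_def)

end

section \<open>Highest weight vectors\<close>

text \<open>The basis elements appear as bare operators with commutation rules, so that the
  reflected operators of \<open>mirror\<close> form another instance of the same locale.\<close>

locale tsv_rep = complex_vector_space scale
  for scale :: "complex \<Rightarrow> 'v::ab_group_add \<Rightarrow> 'v" (infixr "*s" 75) +
  fixes l y m :: "int \<Rightarrow> 'v \<Rightarrow> 'v"
  assumes lin_l: "lin (l n)" and lin_y: "lin (y n)" and lin_m: "lin (m n)"
    and l_l: "l n (l p v) = l p (l n v) + of_int (p - n) *s l (n + p) v"
    and l_y: "l n (y p v) = y p (l n v) + (of_int p - of_int n / 2) *s y (n + p) v"
    and l_m: "l n (m p v) = m p (l n v) + of_int p *s m (n + p) v"
    and y_y: "y n (y p v) = y p (y n v) + of_int (p - n) *s m (n + p) v"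
    and y_m: "y n (m p v) = m p (y n v)"
    and m_m: "m n (m p v) = m p (m n v)"
    and m_0: "\<exists>c. \<forall>v. m 0 v = c *s v"
    and irreducible: "\<lbrakk>subspace W;
      \<And>n w. w \<in> W \<Longrightarrow> l n w \<in> W \<and> y n w \<in> W \<and> m n w \<in> W\<rbrakk> \<Longrightarrow> W = {0} \<or> W = UNIV"
begin

lemmas l_lin = linD[OF lin_l] and y_lin = linD[OF lin_y] and m_lin = linD[OF lin_m]

abbreviation E :: "complex \<Rightarrow> 'v set" where
  "E \<equiv> eigenspace (l 0)"

lemma l_E: "v \<in> E c \<Longrightarrow> c' = c + of_int n \<Longrightarrow> l n v \<in> E c'"
  using l_l[of 0 n v] by (simp add: eigenspace_def l_lin scale_left_distrib)

lemma y_E: "v \<in> E c \<Longrightarrow> c' = c + of_int n \<Longrightarrow> y n v \<in> E c'"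
  using l_y[of 0 n v] by (simp add: eigenspace_def y_lin scale_left_distrib)

lemma m_E: "v \<in> E c \<Longrightarrow> c' = c + of_int n \<Longrightarrow> m n v \<in> E c'"
  using l_m[of 0 n v] by (simp add: eigenspace_def m_lin scale_left_distrib)

lemma subspace_E: "subspace (E c)"
  by (rule eigenspace_subspace[OF lin_l])

lemma span_eq_UNIV:
  assumes "r \<in> R" "r \<noteq> 0"
    and "\<And>n w. w \<in> R \<Longrightarrow> l n w \<in> span R \<and> y n w \<in> span R \<and> m n w \<in> span R"
  shows "span R = UNIV"
proof -
  have "span R = {0} \<or> span R = UNIV"
  proof (rule irreducible[OF subspace_span])
    fix n w assume w: "w \<in> span R"
    have "l n w \<in> span R" "y n w \<in> span R" "m n w \<in> span R"
      by (rule span_image_closed[OF _ _ w]; use lin_l lin_y lin_m assms(3) in blast)+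
    then show "l n w \<in> span R \<and> y n w \<in> span R \<and> m n w \<in> span R" by blast
  qed
  then show ?thesis
    using assms(1,2) span_base[OF assms(1)] by auto
qed

text \<open>Twisting by the involution \<open>L n\<close> to \<open>- L (- n)\<close>,
  \<open>Y n\<close> to \<open>Y (- n)\<close>, \<open>M n\<close> to \<open>- M (- n)\<close> of
  the algebra. It turns results on raising operators into results on lowering operators, with weight
  \<open>c\<close> replaced by \<open>- c\<close>.\<close>

lemma mirror: "tsv_rep scale (\<lambda>n v. - l (- n) v) (\<lambda>n. y (- n)) (\<lambda>n v. - m (- n) v)"
proof unfold_locales
  fix W :: "'v set"
  assume W: "subspace W" "\<And>n w. w \<in> W \<Longrightarrow> - l (- n) w \<in> W \<and> y (- n) w \<in> W \<and> - m (- n) w \<in> W"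
  show "W = {0} \<or> W = UNIV"
  proof (rule irreducible[OF W(1)])
    fix n w assume "w \<in> W"
    then show "l n w \<in> W \<and> y n w \<in> W \<and> m n w \<in> W"
      using W(2)[of w "- n"] subspace_neg[OF W(1)] by force
  qed
next
  obtain c where c: "\<forall>v. m 0 v = c *s v" using m_0 by blast
  then show "\<exists>c. \<forall>v. - m (- 0) v = c *s v"
    by (intro exI[of _ "- c"]) simp
next
  fix n p v
  show "- l (- n) (- l (- p) v) = - l (- p) (- l (- n) v) + of_int (p - n) *s - l (- (n + p)) v"
    using l_l[of "- n" "- p" v] by (simp add: l_lin scale_left_diff_distrib)
  show "- l (- n) (y (- p) v) =
       y (- p) (- l (- n) v) + (of_int p - of_int n / 2) *s y (- (n + p)) v"
    using l_y[of "- n" "- p" v] by (simp add: l_lin y_lin scale_left_diff_distrib)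
  show "- l (- n) (- m (- p) v) = - m (- p) (- l (- n) v) + of_int p *s - m (- (n + p)) v"
    using l_m[of "- n" "- p" v] by (simp add: l_lin m_lin)
  show "y (- n) (y (- p) v) = y (- p) (y (- n) v) + of_int (p - n) *s - m (- (n + p)) v"
    using y_y[of "- n" "- p" v] by (simp add: scale_left_diff_distrib)
  show "y (- n) (- m (- p) v) = - m (- p) (y (- n) v)"
    using y_m[of "- n" "- p" v] by (simp add: y_lin)
  show "- m (- n) (- m (- p) v) = - m (- p) (- m (- n) v)"
    using m_m[of "- n" "- p" v] by (simp add: m_lin)
qed (auto simp: l_lin y_lin m_lin scale_right_distrib)

lemma mirror_E: "eigenspace (\<lambda>v. - l (- 0) v) c = E (- c)"
proof -
  have "- u = c *s v \<longleftrightarrow> u = - (c *s v)" for u v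
    by (metis minus_minus)
  then show ?thesis
    by (simp add: eigenspace_def)
qed

section \<open>Modules generated by highest weight vectors\<close>

definition ops :: "int \<Rightarrow> ('v \<Rightarrow> 'v) set" where
  "ops n = {l n, y n, m n}"

lemma ops_lin: "f \<in> ops n \<Longrightarrow> lin f"
  using lin_l lin_y lin_m by (auto simp: ops_def)

lemma ops_E: "f \<in> ops n \<Longrightarrow> v \<in> E c \<Longrightarrow> c' = c + of_int n \<Longrightarrow> f v \<in> E c'"
  using l_E y_E m_E by (auto simp: ops_def)

text \<open>Every bracket of two basis elements is a multiple of one basis element, so the three
  families can be treated alike; vanishing brackets are covered by the coefficient 0.\<close>

lemma ops_commute:
  assumes "f \<in> ops n" "g \<in> ops p"
  shows "\<exists>c. \<exists>h\<in>ops (n + p). \<forall>v. f (g v) = g (f v) + c *s h v"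
proof -
  have I: ?thesis if "h \<in> ops (n + p)" "\<And>v. f (g v) = g (f v) + c *s h v" for c h
    using that by blast
  have O: "l (n + p) \<in> ops (n + p)" "y (n + p) \<in> ops (n + p)" "m (n + p) \<in> ops (n + p)"
    by (auto simp: ops_def)
  consider "f = l n" "g = l p" | "f = l n" "g = y p" | "f = l n" "g = m p"
    | "f = y n" "g = l p" | "f = m n" "g = l p" | "f = y n" "g = y p"
    | "f \<in> {y n, m n}" "g \<in> {y p, m p}" "f = m n \<or> g = m p"
    using assms by (auto simp: ops_def)
  then show ?thesis
  proof cases
    case 1
    then show ?thesis using I[OF O(1)] l_l by blast
  next
    case 2
    then show ?thesis using I[OF O(2)] l_y by blast
  next
    case 3
    then show ?thesis using I[OF O(3)] l_m by blast
  next
    case 4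
    then show ?thesis
      using l_y[of p n]
      by (intro I[OF O(2), of "- (of_int n - of_int p / 2)"])
        (simp add: add.commute scale_minus_left del: minus_diff_eq)
  next
    case 5
    then show ?thesis
      using l_m[of p n] by (intro I[OF O(3), of "- of_int n"]) (simp add: add.commute)
  next
    case 6
    then show ?thesis using I[OF O(3)] y_y by blast
  next
    case 7
    then show ?thesis using y_m[of n p] y_m[of p n] m_m[of n p] by (intro I[OF O(3), of 0]) auto
  qed
qed

text \<open>Words in lowering operators applied to \<open>X\<close>, graded by total degree. The
  letters are unordered; since each has degree at least one, a finite \<open>X\<close> has only
  finitely many descendants of each depth.\<close>

inductive descendant :: "'v set \<Rightarrow> nat \<Rightarrow> 'v \<Rightarrow> bool" for X where
  base: "x \<in> X \<Longrightarrow> descendant X 0 x"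
| step: "descendant X n v \<Longrightarrow> 0 < i \<Longrightarrow> f \<in> ops (- int i) \<Longrightarrow> descendant X (n + i) (f v)"

lemma finite_descendant:
  assumes "finite X"
  shows "finite {v. descendant X n v}"
proof (induction n rule: less_induct)
  case (less n)
  have "{v. descendant X n v} \<subseteq> X \<union> (\<Union>i\<in>{0<..n}. \<Union>f\<in>ops (- int i). f ` {v. descendant X (n - i) v})"
  proof
    fix v assume "v \<in> {v. descendant X n v}"
    then have "descendant X n v" by simp
    then show "v \<in> X \<union> (\<Union>i\<in>{0<..n}. \<Union>f\<in>ops (- int i). f ` {v. descendant X (n - i) v})"
    proof cases
      case base
      then show ?thesis by simp
    next
      case (step k u i f)
      then have "i \<in> {0<..n}" "f \<in> ops (- int i)" "v \<in> f ` {v. descendant X (n - i) v}"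
        by auto
      then show ?thesis by blast
    qed
  qed
  then show ?case
    by (rule finite_subset) (use less assms in \<open>auto simp: ops_def\<close>)
qed

lemma descendant_E:
  assumes "X \<subseteq> E c" "descendant X n v"
  shows "v \<in> E (c - of_nat n)"
  using assms(2)
proof induction
  case (base x)
  then show ?case using assms(1) by auto
next
  case (step n v i f)
  show ?case
    by (rule ops_E[OF step(3) step.IH]) simp
qed

definition singular :: "'v \<Rightarrow> bool" where
  "singular v \<longleftrightarrow> (\<forall>n>0. \<forall>f\<in>ops n. f v = 0)"

lemma singularD: "singular v \<Longrightarrow> f \<in> ops n \<Longrightarrow> 0 < n \<Longrightarrow> f v = 0"
  by (auto simp: singular_def)

text \<open>Lowering operators prolong the words, operators of degree zero preserve
  \<open>span X\<close>, and raising operators are commuted to the right until they annihilate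
  \<open>X\<close>. Hence the span is a nonzero submodule.\<close>

lemma singular_generates:
  assumes X: "X \<subseteq> E c" "\<And>x. x \<in> X \<Longrightarrow> singular x" "\<And>x. x \<in> X \<Longrightarrow> y 0 x \<in> span X"
    and x: "x \<in> X" "x \<noteq> 0"
  shows "span {v. \<exists>n. descendant X n v} = UNIV"
proof (rule span_eq_UNIV)
  let ?R = "{v. \<exists>n. descendant X n v}"
  show "x \<in> ?R" using x descendant.base by blast
  show "x \<noteq> 0" by fact
  have low: "f v \<in> span ?R" if "descendant X n v" "f \<in> ops p" "p < 0" for f n v p
  proof -
    have "descendant X (n + nat (- p)) (f v)"
      using that by (intro descendant.step) auto
    then show ?thesis by (intro span_base) blast
  qed
  have all: "f v \<in> span ?R" if "descendant X n v" "f \<in> ops p" for f n v p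
    using that
  proof (induction arbitrary: f p)
    case (base x)
    consider "p < 0" | "p = 0" | "p > 0" by linarith
    then show ?case
    proof cases
      case 1
      then show ?thesis using low descendant.base base by blast
    next
      case 2
      obtain d where d: "\<forall>v. m 0 v = d *s v" using m_0 by blast
      have XR: "span X \<subseteq> span ?R"
        by (intro span_mono) (use descendant.base in blast)
      show ?thesis
      proof -
        have xX: "x \<in> span X" "x \<in> E c"
          using base(1) X(1) span_base by auto
        consider "f = l 0" | "f = y 0" | "f = m 0"
          using base(2) 2 by (auto simp: ops_def)
        then have "f x \<in> span X"
          by cases (use xX X(3)[OF base(1)] d in \<open>simp_all add: eigenspace_def span_scale\<close>)
        then show ?thesis using XR by blast
      qed
    next
      case 3
      then show ?thesis using singularD[OF X(2)[OF base(1)] base(2) 3] by (simp add: span_zero)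
    qed
  next
    case (step n v i g)
    \<comment> \<open>The commutator has degree \<open>p - int i\<close>, which may have any sign;
      this is why the induction treats all \<open>f\<close> and \<open>p\<close> at once.\<close>
    obtain d h where h: "h \<in> ops (p - int i)" "f (g v) = g (f v) + d *s h v"
      using ops_commute[OF step.prems step.hyps(3)] by auto
    have "g (f v) \<in> span ?R"
      using step.IH[OF step.prems]
    proof (rule span_image_closed[OF ops_lin[OF step.hyps(3)], rotated])
      fix r assume "r \<in> ?R"
      then obtain k where "descendant X k r" by blast
      then show "g r \<in> span ?R" by (rule low[OF _ step.hyps(3)]) (use step.hyps(2) in simp)
    qed
    then show ?case
      unfolding h(2) using step.IH[OF h(1)] by (intro span_add span_scale)
  qed
  show "l n w \<in> span ?R \<and> y n w \<in> span ?R \<and> m n w \<in> span ?R" if w: "w \<in> ?R" for n w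
  proof -
    obtain k where k: "descendant X k w" using w by blast
    show ?thesis
      using all[OF k, of "l n" n] all[OF k, of "y n" n] all[OF k, of "m n" n] by (simp add: ops_def)
  qed
qed

lemma singular_weight_space:
  assumes X: "X \<subseteq> E c" "\<And>x. x \<in> X \<Longrightarrow> singular x" "\<And>x. x \<in> X \<Longrightarrow> y 0 x \<in> span X"
    and x: "x \<in> X" "x \<noteq> 0"
  shows "E d = span ({v. \<exists>n. descendant X n v} \<inter> E d)"
proof (rule eigenspace_span[OF lin_l _ singular_generates[OF assms]])
  fix r assume "r \<in> {v. \<exists>n. descendant X n v}"
  then obtain n where "descendant X n r" by blast
  then show "\<exists>c. r \<in> E c" using descendant_E[OF X(1)] by blast
qed

text \<open>The top weight space is an irreducible module over the polynomial ring generated by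
  \<open>y 0\<close>; if \<open>y 0 v \<noteq> 0\<close>, then it is already generated by \<open>y 0 v\<close>, so \<open>v\<close> is annihilated by
  a nonzero polynomial in \<open>y 0\<close>.\<close>

lemma singular_imp_fd:
  assumes v: "v \<in> E c" "singular v" "v \<noteq> 0"
  shows "fd (E d)"
proof -
  let ?w = "\<lambda>k. (y 0 ^^ k) v"
  have wE: "?w k \<in> E c" for k
    by (induction k) (use v(1) y_E[of _ c c 0] in simp_all)
  have y0: "y 0 \<in> ops 0"
    by (simp add: ops_def)
  have sing_y: "singular (y 0 u)" if "singular u" for u
    unfolding singular_def
  proof (intro allI impI ballI)
    fix n :: int and f assume f: "0 < n" "f \<in> ops n"
    obtain b h where h: "h \<in> ops n" "f (y 0 u) = y 0 (f u) + b *s h u"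
      using ops_commute[OF f(2) y0] by auto
    then show "f (y 0 u) = 0"
      using singularD[OF that f(2,1)] singularD[OF that h(1) f(1)] by (simp add: y_lin)
  qed
  have wS: "singular (?w k)" for k
    by (induction k) (simp_all add: v(2) sing_y)
  have "\<exists>X. finite X \<and> X \<subseteq> E c \<and> (\<forall>x\<in>X. singular x \<and> y 0 x \<in> span X) \<and> v \<in> X"
  proof (cases "y 0 v = 0")
    case True
    then show ?thesis
      using v by (intro exI[of _ "{v}"]) (auto simp: span_zero)
  next
    case False
    let ?X = "?w ` {1..}"
    have "E c = span ({v. \<exists>n. descendant ?X n v} \<inter> E c)"
    proof (rule singular_weight_space)
      show "y 0 v \<in> ?X" by (rule image_eqI[of _ _ 1]) auto
      show "y 0 x \<in> span ?X" if x: "x \<in> ?X" for x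
      proof -
        obtain k where "x = ?w k" using x by blast
        then show ?thesis by (intro span_base image_eqI[of _ _ "Suc k"]) auto
      qed
    qed (use wE wS False in auto)
    \<comment> \<open>A descendant of depth \<open>n\<close> has weight \<open>c - of_nat n\<close>,
      so only depth zero contributes nonzero vectors to \<open>E c\<close>.\<close>
    moreover have "{v. \<exists>n. descendant ?X n v} \<inter> E c \<subseteq> insert 0 ?X"
    proof
      fix u assume u: "u \<in> {v. \<exists>n. descendant ?X n v} \<inter> E c"
      then obtain n where n: "descendant ?X n u" by blast
      have "u \<in> E (c - of_nat n)"
        by (rule descendant_E[OF _ n]) (use wE in auto)
      then have "u = 0 \<or> n = 0"
        using u eigenspace_unique[of u "l 0" c "c - of_nat n"] by auto
      then show "u \<in> insert 0 ?X"
        using n by (auto elim: descendant.cases)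
    qed
    ultimately have "E c \<subseteq> span (insert 0 ?X)"
      using span_mono by metis
    then have "v \<in> span (insert 0 ?X)"
      using v(1) by blast
    then have "v \<in> span ?X" by (simp add: span_insert_0)
    then obtain T r where T: "finite T" "T \<subseteq> ?X" "v = (\<Sum>a\<in>T. r a *s a)"
      unfolding span_explicit by blast
    have "v \<in> span T"
      unfolding T(3) by (intro span_sum span_scale span_base)
    obtain K where K: "finite K" "K \<subseteq> {1..}" "T = ?w ` K"
      using finite_subset_image[OF T(1,2)] by blast
    have ex: "\<exists>N. v \<in> span (?w ` {1..N})"
    proof
      have "T \<subseteq> ?w ` {1..Max (insert 0 K)}"
        using K by (auto intro!: imageI Max_ge)
      then show "v \<in> span (?w ` {1..Max (insert 0 K)})"
        using \<open>v \<in> span T\<close> span_mono by blast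
    qed
    \<comment> \<open>By minimality the coefficient of \<open>?w N\<close> is nonzero, so
      \<open>?w N\<close> can be exchanged with \<open>v\<close>; the finitely many vectors
      \<open>?w k\<close> with \<open>k\<close> below \<open>N\<close> then have a span stable under
      \<open>y 0\<close>.\<close>
    define N where "N = (LEAST N. v \<in> span (?w ` {1..N}))"
    have N: "v \<in> span (?w ` {1..N})"
      unfolding N_def using ex by (rule LeastI_ex)
    have "N \<noteq> 0" using N v(3) by (cases N) auto
    then obtain N' where N': "N = Suc N'" by (cases N) auto
    have "v \<notin> span (?w ` {1..N'})"
      using not_less_Least[of N' "\<lambda>N. v \<in> span (?w ` {1..N})"] N' unfolding N_def by simp
    moreover have "?w ` {1..N} = insert (?w N) (?w ` {1..N'})"
      unfolding N' by (simp add: atLeastAtMostSuc_conv)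
    ultimately have wN: "?w N \<in> span (insert v (?w ` {1..N'}))"
      using N in_span_insert[of v "?w N" "?w ` {1..N'}"] by simp
    have eq: "insert v (?w ` {1..N'}) = ?w ` {..N'}"
    proof -
      have "{..N'} = insert 0 {1..N'}" by auto
      then show ?thesis by (simp only: image_insert) simp
    qed
    have "y 0 x \<in> span (?w ` {..N'})" if x: "x \<in> ?w ` {..N'}" for x
    proof -
      obtain k where k: "x = ?w k" "k \<le> N'" using x by auto
      show ?thesis
      proof (cases "k = N'")
        case True
        then show ?thesis using k wN eq N' by simp
      next
        case False
        then show ?thesis using k by (intro span_base image_eqI[of _ _ "Suc k"]) auto
      qed
    qed
    then show ?thesis
      using wE wS by (intro exI[of _ "?w ` {..N'}"]) (auto simp: image_iff intro!: bexI[of _ 0])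
  qed
  then obtain X where X: "finite X" "X \<subseteq> E c" "\<And>x. x \<in> X \<Longrightarrow> singular x"
    "\<And>x. x \<in> X \<Longrightarrow> y 0 x \<in> span X" "v \<in> X"
    by blast
  let ?R = "{v. \<exists>n. descendant X n v}"
  have "finite (?R \<inter> E d)"
  proof (cases "\<exists>n. d = c - of_nat n")
    case True
    then obtain n where n: "d = c - of_nat n" by blast
    have "?R \<inter> E d \<subseteq> insert 0 {v. descendant X n v}"
    proof
      fix u assume "u \<in> ?R \<inter> E d"
      then obtain k where "descendant X k u" "u \<in> E d" by blast
      then show "u \<in> insert 0 {v. descendant X n v}"
        using descendant_E[OF X(2), of k u] eigenspace_unique[of u "l 0" d "c - of_nat k"] n by auto
    qed
    then show ?thesis
      by (rule finite_subset) (simp add: finite_descendant[OF X(1)])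
  next
    case False
    have "?R \<inter> E d \<subseteq> {0}"
    proof
      fix u assume "u \<in> ?R \<inter> E d"
      then obtain k where "descendant X k u" "u \<in> E d" by blast
      then show "u \<in> {0}"
        using descendant_E[OF X(2), of k u] eigenspace_unique[of u "l 0" d "c - of_nat k"] False by auto
    qed
    then show ?thesis
      by (rule finite_subset) simp
  qed
  moreover have "E d = span (?R \<inter> E d)"
    by (rule singular_weight_space[OF X(2-5) v(3)])
  ultimately show ?thesis
    unfolding fd_def by metis
qed

end

section \<open>Triviality of the operators Y and M\<close>

context tsv_rep
begin

section \<open>Generators of the positive operators\<close>

lemma E_D: "v \<in> E c \<Longrightarrow> l 0 v = c *s v"
  by (simp add: eigenspace_def)

text \<open>The commutator of \<open>l 1\<close> and \<open>l i\<close> is \<open>i - 1\<close>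
  times \<open>l (1 + i)\<close>, and the factor is nonzero from \<open>i = 2\<close> on.\<close>

lemma l_vanish_above:
  assumes "l 1 v = 0" "2 \<le> j" "l j v = 0" "j \<le> n"
  shows "l n v = 0"
  using assms(4)
proof (induction n rule: int_ge_induct)
  case base
  then show ?case using assms by simp
next
  case (step i)
  have "of_int (i - 1) *s l (1 + i) v = 0"
    using l_l[of 1 i v] assms(1) step.IH by (simp add: l_lin)
  moreover have "of_int (i - 1) \<noteq> (0::complex)"
    using step.hyps assms(2) by (subst of_int_eq_0_iff) simp
  ultimately show ?case by (simp add: add.commute)
qed

text \<open>Here the commutator with \<open>l 1\<close> carries the factor \<open>i - 1/2\<close>,
  which is nonzero for every integer \<open>i\<close>.\<close>

lemma y_vanish_above:
  assumes "l 1 v = 0" "y 1 v = 0" "1 \<le> n"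
  shows "y n v = 0"
  using assms(3)
proof (induction n rule: int_ge_induct)
  case base
  then show ?case using assms by simp
next
  case (step i)
  have "(of_int i - 1 / 2) *s y (1 + i) v = 0"
    using l_y[of 1 i v] assms(1) step.IH by (simp add: l_lin y_lin)
  moreover have "of_int i - 1 / 2 \<noteq> (0::complex)"
  proof
    assume "of_int i - 1 / 2 = (0::complex)"
    then have "of_int (2 * i) = (of_int 1 :: complex)" by (simp add: field_simps)
    then have "2 * i = 1" by (simp only: of_int_eq_iff)
    then show False by presburger
  qed
  ultimately show ?case by (simp add: add.commute)
qed

lemma m_vanish_above:
  assumes "l 1 v = 0" "m 1 v = 0" "1 \<le> n"
  shows "m n v = 0"
  using assms(3)
proof (induction n rule: int_ge_induct)
  case base
  then show ?case using assms by simp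
next
  case (step i)
  have "of_int i *s m (1 + i) v = 0"
    using l_m[of 1 i v] assms(1) step.IH by (simp add: l_lin m_lin)
  then show ?case using step.hyps by (simp add: add.commute)
qed

text \<open>All operators of positive degree arise from these four by commutators with
  \<open>l 1\<close>.\<close>

lemma singularI:
  assumes "l 1 v = 0" "l 2 v = 0" "y 1 v = 0" "m 1 v = 0"
  shows "singular v"
proof -
  have "l n v = 0 \<and> y n v = 0 \<and> m n v = 0" if "0 < n" for n
    using l_vanish_above[OF assms(1) _ assms(2), of n] y_vanish_above[OF assms(1,3), of n]
      m_vanish_above[OF assms(1,4), of n] assms(1) that by (cases "n = 1") auto
  then show ?thesis
    by (auto simp: singular_def ops_def)
qed

text \<open>Where a finite-dimensional weight space follows an infinite-dimensional one, some nonzero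
  vector is annihilated by all \<open>y n\<close> and \<open>m n\<close>; the annihilator of these is a submodule.\<close>

lemma y_m_trivial:
  assumes inf: "\<not> fd (E c)" and fin: "fd (E (c + 1))"
  shows "y n v = 0" "m n v = 0"
proof -
  \<comment> \<open>All these operators map \<open>E c\<close> into \<open>E (c + 1)\<close>. The
    first set annihilates \<open>a\<close> in degree 1, the second annihilates \<open>l 2 a\<close>
    in degree -1.\<close>
  let ?F = "ops 1 \<union> (\<lambda>f v. f (l 2 v)) ` ops (- 1)"
  have F: "lin f \<and> (\<exists>Z. fd Z \<and> f ` E c \<subseteq> Z)" if f: "f \<in> ?F" for f
  proof -
    have "lin f \<and> f ` E c \<subseteq> E (c + 1)"
      using f
    proof
      assume "f \<in> ops 1"
      then show ?thesis using ops_lin ops_E[of f 1 _ c "c + 1"] by auto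
    next
      assume "f \<in> (\<lambda>f v. f (l 2 v)) ` ops (- 1)"
      then obtain g where g: "g \<in> ops (- 1)" "f = (\<lambda>v. g (l 2 v))" by blast
      have "g (l 2 v) \<in> E (c + 1)" if "v \<in> E c" for v
        by (rule ops_E[OF g(1) l_E[OF that refl]]) simp
      then show ?thesis
        unfolding g(2) using linD(1,2)[OF ops_lin[OF g(1)]] by (auto intro!: linI simp: l_lin)
    qed
    then show ?thesis using fin by blast
  qed
  obtain a where a: "a \<in> E c" "a \<noteq> 0" "\<And>f. f \<in> ?F \<Longrightarrow> f a = 0"
    by (rule common_kernel[OF _ subspace_E inf, of ?F]) (use F in \<open>auto simp: ops_def\<close>)
  have a0: "l 1 a = 0" "y 1 a = 0" "m 1 a = 0"
    using a(3)[of "l 1"] a(3)[of "y 1"] a(3)[of "m 1"] by (simp_all add: ops_def)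
  define b where "b = l 2 a"
  have b0: "l (-1) b = 0" "y (-1) b = 0" "m (-1) b = 0"
    using a(3)[of "\<lambda>v. l (-1) (l 2 v)"] a(3)[of "\<lambda>v. y (-1) (l 2 v)"] a(3)[of "\<lambda>v. m (-1) (l 2 v)"]
    by (simp_all add: b_def ops_def)
  \<comment> \<open>Otherwise \<open>a\<close> would be singular and \<open>E c\<close>
    finite-dimensional.\<close>
  have "b \<noteq> 0"
    using singularI[of a] singular_imp_fd[OF a(1), of c] a(2) a0 inf by (auto simp: b_def)
  have pos: "y n b = 0 \<and> m n b = 0" if "1 \<le> n" for n
    using l_y[of 2 n a] l_m[of 2 n a] y_vanish_above[OF a0(1,2), of n] m_vanish_above[OF a0(1,3), of n]
      y_vanish_above[OF a0(1,2), of "2 + n"] m_vanish_above[OF a0(1,3), of "2 + n"] that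
    by (simp add: b_def l_lin)
  interpret mir: tsv_rep scale "\<lambda>n v. - l (- n) v" "\<lambda>n. y (- n)" "\<lambda>n v. - m (- n) v"
    by (rule mirror)
  have neg: "y n b = 0 \<and> m n b = 0" if "n \<le> - 1" for n
    using mir.y_vanish_above[of b "- n"] mir.m_vanish_above[of b "- n"] b0 that by simp
  \<comment> \<open>The commutators of \<open>l (-1)\<close> with \<open>y 1\<close> and
    \<open>m 1\<close> are nonzero multiples of \<open>y 0\<close> and \<open>m 0\<close>.\<close>
  have zero: "y 0 b = 0 \<and> m 0 b = 0"
    using l_y[of "-1" 1 b] l_m[of "-1" 1 b] b0(1) pos[of 1] by (simp add: l_lin y_lin m_lin)
  have b: "y n b = 0 \<and> m n b = 0" for n
  proof -
    consider "n \<le> - 1" | "n = 0" | "1 \<le> n" by linarith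
    then show ?thesis using pos neg zero by cases auto
  qed
  let ?W = "{v. \<forall>n. y n v = 0 \<and> m n v = 0}"
  have "?W = {0} \<or> ?W = UNIV"
  proof (rule irreducible)
    show "subspace ?W"
      by (auto simp: subspace_def y_lin m_lin)
    fix n w assume "w \<in> ?W"
    then have w: "y k w = 0" "m k w = 0" for k by auto
    have "y k (l n w) = 0" for k
      using l_y[of n k w] w by (simp add: l_lin)
    moreover have "m k (l n w) = 0" for k
      using l_m[of n k w] w by (simp add: l_lin)
    ultimately show "l n w \<in> ?W \<and> y n w \<in> ?W \<and> m n w \<in> ?W"
      using w by (simp add: y_lin m_lin)
  qed
  then have "v \<in> ?W"
    using b \<open>b \<noteq> 0\<close> by auto
  then show "y n v = 0" "m n v = 0" by auto
qed

end

section \<open>Modules over the Witt algebra\<close>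

locale witt_rep = tsv_rep +
  assumes y_zero: "y n v = 0" and m_zero: "m n v = 0"
    and infinite: "\<exists>c. \<not> fd (E c)"
begin

lemma mirror_witt: "witt_rep scale (\<lambda>n v. - l (- n) v) (\<lambda>n. y (- n)) (\<lambda>n v. - m (- n) v)"
proof -
  interpret mir: tsv_rep scale "\<lambda>n v. - l (- n) v" "\<lambda>n. y (- n)" "\<lambda>n v. - m (- n) v"
    by (rule mirror)
  obtain c where "\<not> fd (E c)" using infinite by blast
  then have "\<not> fd (eigenspace (\<lambda>v. - l (- 0) v) (- c))"
    by (simp add: mirror_E del: minus_zero)
  then show ?thesis
    by unfold_locales (auto simp: y_zero m_zero)
qed

text \<open>A nonzero singular vector makes every weight space finite-dimensional, against
  \<open>infinite\<close>; with \<open>y\<close> and \<open>m\<close> zero, \<open>l 1\<close> and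
  \<open>l 2\<close> decide singularity.\<close>

lemma no_highest: "v \<in> E c \<Longrightarrow> l 1 v = 0 \<Longrightarrow> l 2 v = 0 \<Longrightarrow> v = 0"
  using singular_imp_fd[OF _ singularI, of v c] infinite y_zero m_zero by metis

lemma no_lowest:
  assumes "v \<in> E c" "l (-1) v = 0" "l (-2) v = 0"
  shows "v = 0"
proof -
  interpret mir: witt_rep scale "\<lambda>n v. - l (- n) v" "\<lambda>n. y (- n)" "\<lambda>n v. - m (- n) v"
    by (rule mirror_witt)
  show ?thesis
    by (rule mir.no_highest[of v "- c"]) (use assms in \<open>simp_all add: eigenspace_def\<close>)
qed

section \<open>Consequences of two finite-dimensional weight spaces\<close>

lemma l_vanish_below:
  assumes "l (-1) v = 0" "l n v = 0" "j \<le> n" "0 \<le> j"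
  shows "l j v = 0"
  using assms(3,4)
proof (induction j rule: int_le_induct)
  case base
  then show ?case using assms by simp
next
  case (step i)
  \<comment> \<open>The commutator of \<open>l (-1)\<close> and \<open>l i\<close> is
    \<open>i + 1\<close> times \<open>l (i - 1)\<close>, which permits the descent while
    \<open>i\<close> is nonnegative.\<close>
  have "of_int (i + 1) *s l (i - 1) v = 0"
    using l_l[of "-1" i v] assms(1) step by (simp add: l_lin)
  moreover have "of_int (i + 1) \<noteq> (0::complex)"
    using step.prems by (subst of_int_eq_0_iff) simp
  ultimately show ?case by simp
qed

lemma comp_l_lin:
  assumes "lin f"
  shows "lin (\<lambda>v. f (l n v))"
  by (intro linI) (simp_all add: l_lin linD(1,2)[OF assms])

text \<open>Some \<open>v\<close> \<noteq> 0 in \<open>E c\<close> is annihilated by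
  \<open>l 1\<close>, by \<open>l j\<close> and by \<open>l (-1)\<close> after \<open>l 2\<close>.
  Then \<open>l n v = 0\<close> for all \<open>n\<close> \<ge> \<open>j\<close>, so
  \<open>l j\<close> and \<open>l (-1)\<close> annihilate \<open>l 2 v\<close>. Descending from
  \<open>j\<close> makes \<open>l 2 v\<close> singular, hence zero, and then \<open>v\<close> itself
  is singular.\<close>

lemma two_finite:
  assumes inf: "\<not> fd (E c)" and fin: "fd (E (c + 1))" "fd (E (c + of_int j))" and j: "2 \<le> j"
  shows False
proof -
  let ?F = "{l 1, l j, \<lambda>v. l (-1) (l 2 v)}"
  have img: "l 1 ` E c \<subseteq> E (c + 1)" "l j ` E c \<subseteq> E (c + of_int j)"
    "(\<lambda>v. l (-1) (l 2 v)) ` E c \<subseteq> E (c + 1)"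
    by (safe intro!: l_E[of _ c] l_E[OF l_E[OF _ refl]]) simp_all
  obtain v where v: "v \<in> E c" "v \<noteq> 0" "\<And>f. f \<in> ?F \<Longrightarrow> f v = 0"
  proof (rule common_kernel[OF _ subspace_E inf, of ?F])
    show "lin f \<and> (\<exists>Z. fd Z \<and> f ` E c \<subseteq> Z)" if "f \<in> ?F" for f
      using that
    proof (elim insertE emptyE)
    qed (use img fin lin_l comp_l_lin[OF lin_l] in \<open>simp, blast\<close>)+
  qed auto
  have v1: "l 1 v = 0" "l j v = 0" and w1: "l (-1) (l 2 v) = 0"
    using v(3)[of "l 1"] v(3)[of "l j"] v(3)[of "\<lambda>v. l (-1) (l 2 v)"] by simp_all
  have "l j (l 2 v) = 0"
    using l_l[of j 2 v] v1 l_vanish_above[OF v1(1) j v1(2), of "j + 2"] by (simp add: l_lin)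
  then have "l 1 (l 2 v) = 0" "l 2 (l 2 v) = 0"
    using l_vanish_below[OF w1, of j] j by simp_all
  then have "l 2 v = 0"
    by (rule no_highest[OF l_E[OF v(1) refl]])
  then show False
    using no_highest[OF v(1) v1(1)] v(2) by blast
qed

section \<open>Polynomial constraints on the weight\<close>

text \<open>Here \<open>z\<close> is annihilated by \<open>l (-1)\<close> and \<open>l (-k)\<close> for \<open>k \<ge> 3\<close>, and the same holds for
  \<open>w = l (-2) z\<close>. Then \<open>l (-2) w\<close> is a lowest weight vector.\<close>

lemma lowest_vanishing:
  assumes z: "z \<in> E c" "l (-1) z = 0" "l (-1) (l (-2) z) = 0" "l 1 (l (-2) (l (-2) z)) = 0"
  shows "z = 0"
proof -
  define w where "w = l (-2) z"
  define u where "u = l (-2) w"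
  have wE: "w \<in> E (c - 2)"
    unfolding w_def by (rule l_E[OF z(1)]) simp
  have uE: "u \<in> E (c - 4)"
    unfolding u_def by (rule l_E[OF wE]) simp
  have z3: "l (-3) z = 0"
    using l_l[of "-1" "-2" z] z by (simp add: l_lin)
  have z4: "l (-4) z = 0"
    using l_l[of "-1" "-3" z] z z3 by (simp add: l_lin)
  have z5: "l (-5) z = 0"
    using l_l[of "-1" "-4" z] z z4 by (simp add: l_lin)
  have z6: "l (-6) z = 0"
    using l_l[of "-1" "-5" z] z z5 by (simp add: l_lin)
  have z7: "l (-7) z = 0"
    using l_l[of "-1" "-6" z] z z6 by (simp add: l_lin)
  have w3: "l (-3) w = 0"
    using l_l[of "-3" "-2" z] z3 z5 by (simp add: w_def l_lin)
  have w5: "l (-5) w = 0"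
    using l_l[of "-5" "-2" z] z5 z7 by (simp add: w_def l_lin)
  have u1: "l 1 u = 0"
    using z by (simp add: u_def w_def)
  have u3: "l (-3) u = 0"
    using l_l[of "-3" "-2" w] w3 w5 by (simp add: u_def l_lin)
  \<comment> \<open>The vector \<open>u\<close> is annihilated by \<open>l 1\<close> and
    \<open>l (-3)\<close>, hence by their commutator, a multiple of \<open>l (-2)\<close>; commuting
    \<open>l 1\<close> with \<open>l (-2)\<close> then reaches \<open>l (-1)\<close>.\<close>
  have u2: "l (-2) u = 0"
    using l_l[of 1 "-3" u] u1 u3 by (simp add: l_lin)
  have "l (-1) u = 0"
    using l_l[of 1 "-2" u] u1 u2 by (simp add: l_lin)
  then have "u = 0"
    using no_lowest[OF uE] u2 by blast
  then have "w = 0"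
    using no_lowest[OF wE] z(3) by (simp add: u_def w_def)
  then show ?thesis
    using no_lowest[OF z(1,2)] by (simp add: w_def)
qed

text \<open>The combinations \<open>z\<close> and \<open>z'\<close> of \<open>l 2 b\<close>, \<open>l 1 (l 1 b)\<close> and of \<open>l 2 (l 1 b)\<close>,
  \<open>l 1 (l 1 (l 1 b))\<close> are chosen such that \<open>l (-1)\<close> annihilates them.\<close>

lemma lowest_relations:
  assumes b: "b \<in> E (s + 1)" "b \<noteq> 0" "l (-1) b = 0"
    and d: "d = l (-2) b" "l 1 d = 0" "l (-1) (l 2 d) = 0" "l 1 (l (-2) (l 2 d)) = 0"
  shows "(4 * s + 6) *s l 2 d = (- ((s + 1) * (16 * s + 6))) *s b"
    and "s + 1 \<noteq> 0" and "s * (8 * s\<^sup>2 + 17 * s + 8) = 0"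
    and "d \<noteq> 0"
proof -
  define e1 where "e1 = l 1 b"
  define e2 where "e2 = l 1 e1"
  define e3 where "e3 = l 1 e2"
  have dE: "d \<in> E (s - 1)"
    unfolding d(1) by (rule l_E[OF b(1)]) simp
  have e1E: "e1 \<in> E (s + 2)"
    unfolding e1_def by (rule l_E[OF b(1)]) simp
  have e2E: "e2 \<in> E (s + 3)"
    unfolding e2_def by (rule l_E[OF e1E]) simp
  show d0: "d \<noteq> 0"
    using no_lowest[OF b(1,3)] b(2) d(1) by auto
  have f1: "l (-1) e1 = (2 * (s + 1)) *s b"
    using l_l[of "-1" 1 b] b(3) E_D[OF b(1)] by (simp add: e1_def l_lin)
  have f2: "l (-1) e2 = (4 * s + 6) *s e1"
    using l_l[of "-1" 1 e1] f1 E_D[OF e1E]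
    by (simp add: e1_def[symmetric] e2_def[symmetric] l_lin scale_left_distrib[symmetric])
  have f3: "l (-1) e3 = (6 * s + 12) *s e2"
    using l_l[of "-1" 1 e2] f2 E_D[OF e2E]
    by (simp add: e2_def[symmetric] e3_def[symmetric] l_lin scale_left_distrib[symmetric])
  have g1: "l (-2) e1 = 0"
    using l_l[of "-2" 1 b] d(1,2) b(3) by (simp add: e1_def l_lin)
  have g2: "l (-2) e2 = (6 * (s + 1)) *s b"
    using l_l[of "-2" 1 e1] g1 f1 by (simp add: e2_def l_lin)
  have g3: "l (-2) e3 = (18 * s + 24) *s e1"
    using l_l[of "-2" 1 e2] g2 f2
    by (simp add: e1_def[symmetric] e3_def[symmetric] l_lin scale_left_distrib[symmetric])
  have x1: "l (-1) (l 2 b) = 3 *s e1"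
    using l_l[of "-1" 2 b] b(3) by (simp add: e1_def l_lin)
  have x2: "l (-2) (l 2 b) = l 2 d + (4 * (s + 1)) *s b"
    using l_l[of "-2" 2 b] E_D[OF b(1)] by (simp add: d(1) l_lin)
  define z where "z = (4 * s + 6) *s l 2 b - 3 *s e2"
  have zE: "z \<in> E (s + 3)"
    unfolding z_def
    by (intro subspace_diff subspace_scale subspace_E e2E l_E[OF b(1)]) simp
  have z1: "l (-1) z = 0"
    by (simp add: z_def l_lin x1 f2 mult.commute)
  have z2: "l (-2) z = (4 * s + 6) *s l 2 d + ((s + 1) * (16 * s + 6)) *s b"
  proof -
    have "l (-2) z = (4 * s + 6) *s l 2 d + ((4 * s + 6) * (4 * (s + 1)) - 3 * (6 * (s + 1))) *s b"
      by (simp add: z_def l_lin x2 g2 scale_right_distrib scale_left_diff_distrib)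
    also have "(4 * s + 6) * (4 * (s + 1)) - 3 * (6 * (s + 1)) = (s + 1) * (16 * s + 6)"
      by (simp add: algebra_simps)
    finally show ?thesis .
  qed
  \<comment> \<open>\<open>l (-2) z\<close> is a combination of \<open>l 2 d\<close> and
    \<open>b\<close>, both annihilated by \<open>l (-1)\<close> and by \<open>l 1\<close> after
    \<open>l (-2)\<close>.\<close>
  have z0: "z = 0"
    by (rule lowest_vanishing[OF zE z1])
       (simp_all add: z2 l_lin b(3) d(2-4) d(1)[symmetric])
  have "(4 * s + 6) *s l 2 d + ((s + 1) * (16 * s + 6)) *s b = 0"
    using z2 z0 by (simp add: l_lin)
  then show R: "(4 * s + 6) *s l 2 d = (- ((s + 1) * (16 * s + 6))) *s b"
    by (simp only: scale_minus_left add_eq_0_iff2)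
  \<comment> \<open>For \<open>s = - 1\<close> the relation reads \<open>2 *s l 2 d = 0\<close>,
    which makes \<open>d\<close> a highest weight vector.\<close>
  show s1: "s + 1 \<noteq> 0"
  proof
    assume s: "s + 1 = 0"
    then have "s = - 1" by (simp add: add_eq_0_iff2)
    then have "l 2 d = 0" using R s by simp
    then show False using no_highest[OF dE d(2)] d0 by blast
  qed
  have lb: "(4 * s + 6) *s l 2 b = 3 *s e2"
    using z0 by (simp add: z_def)
  \<comment> \<open>The coefficient of \<open>e1\<close> in \<open>l (-2) z'\<close>: 12 times the
    cubic of the claim. The rest of the proof forces it to vanish.\<close>
  define k where "k = 12 * (s * (8 * s\<^sup>2 + 17 * s + 8))"
  define z' where "z' = ((4 * s + 6) * (6 * s + 12)) *s l 2 e1 - (18 * s + 24) *s e3"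
  have X1: "(4 * s + 6) *s l (-1) (l 2 e1) = (18 * s + 24) *s e2"
  proof -
    have "l (-1) (l 2 e1) = (2 * (s + 1)) *s l 2 b + 3 *s e2"
      using l_l[of "-1" 2 e1] f1 by (simp add: e2_def l_lin)
    then have "(4 * s + 6) *s l (-1) (l 2 e1)
        = (2 * (s + 1)) *s ((4 * s + 6) *s l 2 b) + (3 * (4 * s + 6)) *s e2"
      by (simp add: scale_right_distrib mult.commute)
    also have "\<dots> = (2 * (s + 1) * 3 + 3 * (4 * s + 6)) *s e2"
      unfolding lb by (simp only: scale_scale scale_left_distrib)
    finally show ?thesis
      by (simp add: algebra_simps)
  qed
  have X2: "l (-2) (l 2 e1) = (4 * (s + 2)) *s e1"
    using l_l[of "-2" 2 e1] g1 E_D[OF e1E] by (simp add: l_lin)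
  have z1': "l (-1) z' = 0"
  proof -
    have "l (-1) z' = (6 * s + 12) *s ((4 * s + 6) *s l (-1) (l 2 e1)) - (18 * s + 24) *s l (-1) e3"
      by (simp add: z'_def l_lin mult.commute)
    then show ?thesis
      unfolding X1 f3 by (simp add: mult.commute)
  qed
  have z2': "l (-2) z' = k *s e1"
  proof -
    have "l (-2) z' = ((4 * s + 6) * (6 * s + 12) * (4 * (s + 2)) - (18 * s + 24) * (18 * s + 24)) *s e1"
      by (simp add: z'_def l_lin X2 g3 scale_left_diff_distrib)
    also have "(4 * s + 6) * (6 * s + 12) * (4 * (s + 2)) - (18 * s + 24) * (18 * s + 24) = k"
      by (simp add: k_def power2_eq_square algebra_simps)
    finally show ?thesis .
  qed
  have z3': "l (-3) z' = (- (k * (2 * (s + 1)))) *s b"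
    using l_l[of "-1" "-2" z'] z1' z2' f1 by (simp add: l_lin eq_neg_iff_add_eq_0 add.commute)
  have z4': "l (-4) z' = 0"
    using l_l[of "-1" "-3" z'] z1' z3' b(3) by (simp add: l_lin)
  have z5': "l (-5) z' = 0"
    using l_l[of "-1" "-4" z'] z1' z4' by (simp add: l_lin)
  have b3: "l (-3) b = - l (-1) d"
    using l_l[of "-1" "-2" b] b(3) by (simp add: l_lin d(1) eq_neg_iff_add_eq_0 add.commute)
  have "l 1 (l (-1) d) = (- 2 * (s - 1)) *s d"
    using l_l[of 1 "-1" d] d(2) E_D[OF dE] by (simp add: l_lin)
  then have e13: "l (-3) e1 = (2 * (s + 1)) *s d"
    using l_l[of "-3" 1 b] b3 d(1)
    by (simp add: e1_def l_lin scale_left_distrib[symmetric] flip: scale_minus_left)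
  \<comment> \<open>Since \<open>l (-5) z' = 0\<close>, the operators \<open>l (-2)\<close> and
    \<open>l (-3)\<close> commute on \<open>z'\<close>, yet the two orders give opposite multiples
    of \<open>d\<close>.\<close>
  have "(4 * (k * (s + 1))) *s d = 0"
  proof -
    have "(- (k * (2 * (s + 1)))) *s d = (k * (2 * (s + 1))) *s d"
      using l_l[of "-2" "-3" z'] z2' z3' z5' e13 by (simp add: l_lin d(1))
    then have "(k * (2 * (s + 1)) - - (k * (2 * (s + 1)))) *s d = 0"
      by (simp only: scale_left_diff_distrib) simp
    then show ?thesis
      by (simp add: algebra_simps)
  qed
  then have "k = 0"
    using d0 s1 by simp
  then show "s * (8 * s\<^sup>2 + 17 * s + 8) = 0"
    by (simp add: k_def)
qed

section \<open>The module of functions modulo constants\<close>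

text \<open>In the module of functions modulo constants, with basis \<open>v_j\<close> (\<open>j \<noteq> 0\<close>) and
  \<open>l n v_j = j v_(n+j)\<close>, the vector \<open>e k\<close> below is \<open>v_(k+1)\<close>, and \<open>d\<close> is \<open>v_(-1)\<close>.\<close>

lemma ladder:
  assumes b: "b \<in> E 1" "l (-1) b = 0" and d: "d = l (-2) b" "l 1 d = 0" "l 2 d = - b"
  obtains R where "b \<in> R" "\<And>r. r \<in> R \<Longrightarrow> \<exists>n>0. r \<in> E (of_nat n)"
    "\<And>r. r \<in> R \<Longrightarrow> l 1 r \<in> span R \<and> l (-1) r \<in> span R \<and> l 2 r \<in> span R"
    "\<And>r. r \<in> R \<Longrightarrow> l (-2) r \<in> span (insert d R)"
proof -
  \<comment> \<open>Iterating \<open>l 1\<close> on \<open>v_1\<close> multiplies by 1, 2, ...,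
    \<open>k\<close> in turn, so it reaches \<open>fact k\<close> times \<open>v_(k+1)\<close>; the
    division normalizes this.\<close>
  define e where "e k = (1 / fact k) *s (l 1 ^^ k) b" for k
  have e0: "e 0 = b" by (simp add: e_def)
  have l1: "l 1 (e k) = (of_nat k + 1) *s e (Suc k)" for k
  proof -
    have "(1 / fact k :: complex) = (of_nat k + 1) / fact (Suc k)"
      by (simp add: field_simps del: of_nat_Suc) (simp add: algebra_simps)
    then show ?thesis
      by (simp add: e_def l_lin)
  qed
  have cancel: "u = v" if "(of_nat k + 1) *s u = (of_nat k + 1) *s v" for k u v
  proof -
    have "of_nat k + 1 \<noteq> (0::complex)"
      by (metis of_nat_neq_0 add.commute of_nat_Suc)
    then show ?thesis using that by simp
  qed
  have eE: "e k \<in> E (of_nat k + 1)" for k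
  proof -
    have "(l 1 ^^ k) b \<in> E (of_nat k + 1)"
    proof (induction k)
      case 0
      then show ?case using b(1) by simp
    next
      case (Suc k)
      then show ?case using l_E[OF Suc, of _ 1] by (simp add: add.commute)
    qed
    then show ?thesis
      unfolding e_def by (rule subspace_scale[OF subspace_E])
  qed
  have lm1: "l (-1) (e (Suc k)) = (of_nat k + 2) *s e k" for k
  proof (induction k)
    case 0
    show ?case
      using l_l[of "-1" 1 "e 0"] l1[of 0] b E_D[OF b(1)] by (simp add: e0 l_lin)
  next
    case (Suc j)
    show ?case
    proof (rule cancel)
      show "(of_nat (Suc j) + 1) *s l (-1) (e (Suc (Suc j)))
          = (of_nat (Suc j) + 1) *s (of_nat (Suc j) + 2) *s e (Suc j)"
        using l_l[of "-1" 1 "e (Suc j)"] l1[of "Suc j"] l1[of j] Suc E_D[OF eE[of "Suc j"]]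
        by (simp add: l_lin flip: scale_left_distrib) (simp add: algebra_simps)
    qed
  qed
  have lm2: "l (-2) (e 1) = 0"
    using l_l[of "-2" 1 "e 0"] l1[of 0] b d by (simp add: e0 l_lin)
  have lm2': "l (-2) (e (Suc (Suc k))) = (of_nat k + 3) *s e k" for k
  proof (induction k)
    case 0
    show ?case
    proof (rule cancel)
      show "(of_nat 1 + 1) *s l (-2) (e (Suc (Suc 0))) = (of_nat 1 + 1) *s (of_nat 0 + 3) *s e 0"
        using l_l[of "-2" 1 "e 1"] l1[of 1] lm2 lm1[of 0] by (simp add: l_lin)
    qed
  next
    case (Suc j)
    show ?case
    proof (rule cancel)
      show "(of_nat (Suc (Suc j)) + 1) *s l (-2) (e (Suc (Suc (Suc j))))
          = (of_nat (Suc (Suc j)) + 1) *s (of_nat (Suc j) + 3) *s e (Suc j)"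
        using l_l[of "-2" 1 "e (Suc (Suc j))"] l1[of "Suc (Suc j)"] l1[of j] Suc lm1[of "Suc j"]
        by (simp add: l_lin flip: scale_left_distrib) (simp add: algebra_simps)
    qed
  qed
  have l2: "l 2 (e k) = (of_nat k + 1) *s e (Suc (Suc k))" for k
  proof (induction k rule: less_induct)
    case (less k)
    \<comment> \<open>The defect of the expected formula. It is shown to be annihilated by
      \<open>l (-1)\<close> and \<open>l (-2)\<close>, so it vanishes because there are no lowest
      weight vectors.\<close>
    let ?x = "l 2 (e k) - (of_nat k + 1) *s e (Suc (Suc k))"
    have xE: "?x \<in> E (of_nat k + 3)"
      using eE[of "Suc (Suc k)"] by (intro subspace_diff subspace_scale subspace_E l_E[OF eE[of k]])
        (simp_all add: add.commute)
    have x1: "l (-1) ?x = 0"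
    proof (cases k)
      case 0
      then show ?thesis
        using l_l[of "-1" 2 b] b l1[of 0] lm1[of 1] by (simp add: e0 l_lin)
    next
      case (Suc j)
      have "l 2 (l (-1) (e k)) = ((of_nat j + 2) * (of_nat j + 1)) *s e (Suc k)"
        using less[of j] lm1[of j] Suc by (simp add: l_lin)
      then have "l (-1) ?x = ((of_nat j + 2) * (of_nat j + 1)) *s e (Suc k)
          + (3 * (of_nat k + 1)) *s e (Suc k) - ((of_nat k + 1) * (of_nat (Suc k) + 2)) *s e (Suc k)"
        using l_l[of "-1" 2 "e k"] l1[of k] lm1[of "Suc k"] by (simp add: l_lin)
      also have "\<dots> = ((of_nat j + 2) * (of_nat j + 1) + 3 * (of_nat k + 1)
          - (of_nat k + 1) * (of_nat (Suc k) + 2)) *s e (Suc k)"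
        by (simp only: scale_left_diff_distrib scale_left_distrib)
      also have "\<dots> = 0"
        using Suc by (simp add: algebra_simps)
      finally show ?thesis .
    qed
    have x2: "l (-2) ?x = 0"
    proof -
      consider "k = 0" | "k = 1" | j where "k = Suc (Suc j)"
        by (metis One_nat_def nat.exhaust)
      then show ?thesis
      proof cases
        case 1
        \<comment> \<open>The three terms come from \<open>l 2 d = - b\<close>, from
          \<open>4 *s l 0 b\<close>, and from \<open>l (-2)\<close> applied to
          \<open>e 2\<close>.\<close>
        have "l (-2) ?x = (- 1 + 4 - 3) *s b"
          using l_l[of "-2" 2 b] d E_D[OF b(1)] lm2'[of 0] 1
          by (simp only: scale_left_distrib scale_left_diff_distrib) (simp add: e0 l_lin)
        then show ?thesis by simp
      next
        case 2
        then show ?thesis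
          using l_l[of "-2" 2 "e 1"] lm2 E_D[OF eE[of 1]] lm2'[of 1] by (simp add: l_lin)
      next
        case 3
        have "l 2 (l (-2) (e k)) = ((of_nat j + 3) * (of_nat j + 1)) *s e k"
          using less[of j] lm2'[of j] 3 by (simp add: l_lin)
        then have "l (-2) ?x = ((of_nat j + 3) * (of_nat j + 1)) *s e k
            + (4 * (of_nat k + 1)) *s e k - ((of_nat k + 1) * (of_nat k + 3)) *s e k"
          using l_l[of "-2" 2 "e k"] lm2'[of k] E_D[OF eE[of k]] by (simp add: l_lin)
        also have "\<dots> = ((of_nat j + 3) * (of_nat j + 1) + 4 * (of_nat k + 1)
            - (of_nat k + 1) * (of_nat k + 3)) *s e k"
          by (simp only: scale_left_diff_distrib scale_left_distrib)
        also have "\<dots> = 0"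
          using 3 by (simp add: algebra_simps)
        finally show ?thesis .
      qed
    qed
    show ?case
      using no_lowest[OF xE x1 x2] by simp
  qed
  have eR: "e k \<in> span (range e)" for k
    by (intro span_base) simp
  show thesis
  proof (rule that)
    show "b \<in> range e" using e0 by auto
    show "\<exists>n>0. r \<in> E (of_nat n)" if r: "r \<in> range e" for r
    proof -
      obtain k where "r = e k" using r by blast
      then show ?thesis using eE[of k] by (intro exI[of _ "Suc k"]) (simp add: add.commute)
    qed
    show "l 1 r \<in> span (range e) \<and> l (-1) r \<in> span (range e) \<and> l 2 r \<in> span (range e)"
      if r: "r \<in> range e" for r
    proof -
      obtain k where k: "r = e k" using r by blast
      have "l (-1) r \<in> span (range e)"
        using k e0 b lm1 eR by (cases k) (simp_all add: span_zero span_scale)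
      then show ?thesis
        using k l1 l2 eR by (simp add: span_scale)
    qed
    show "l (-2) r \<in> span (insert d (range e))" if r: "r \<in> range e" for r
    proof -
      obtain k where k: "r = e k" using r by blast
      consider "k = 0" | "k = 1" | j where "k = Suc (Suc j)"
        by (metis One_nat_def nat.exhaust)
      then show ?thesis
        by cases (use k e0 d(1) lm2 lm2' in \<open>simp_all add: span_base span_zero span_scale\<close>)
    qed
  qed
qed

lemma l_positive_closed:
  assumes W: "subspace W" "\<And>w. w \<in> W \<Longrightarrow> l 1 w \<in> W \<and> l 2 w \<in> W"
    and n: "1 \<le> n" and w: "w \<in> W"
  shows "l n w \<in> W"
proof (cases "n = 1")
  case True
  then show ?thesis using W(2) w by simp
next
  case False
  then have "2 \<le> n" using n by simp
  then show ?thesis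
    using w
  proof (induction n arbitrary: w rule: int_ge_induct)
    case base
    then show ?case using W(2) by simp
  next
    case (step i)
    have "of_int (i - 1) *s l (i + 1) w = l 1 (l i w) - l i (l 1 w)"
      using l_l[of 1 i w] by (simp add: add.commute)
    also have "\<dots> \<in> W"
      using step W by (intro subspace_diff) auto
    finally have "(1 / of_int (i - 1)) *s of_int (i - 1) *s l (i + 1) w \<in> W"
      by (rule subspace_scale[OF W(1)])
    moreover have "of_int (i - 1) \<noteq> (0::complex)"
      using step.hyps by (subst of_int_eq_0_iff) simp
    ultimately show ?case by simp
  qed
qed

text \<open>Degrees 1, 2, -1 and -2 generate the Witt algebra: the higher degrees come from
  commutators with \<open>l 1\<close>, the negative ones by reflection, and \<open>l 0\<close> is
  half the commutator of \<open>l (-1)\<close> and \<open>l 1\<close>.\<close>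

lemma l_closed:
  assumes W: "subspace W"
    "\<And>w. w \<in> W \<Longrightarrow> l 1 w \<in> W \<and> l 2 w \<in> W \<and> l (-1) w \<in> W \<and> l (-2) w \<in> W"
    and w: "w \<in> W"
  shows "l n w \<in> W"
proof -
  interpret mir: witt_rep scale "\<lambda>n v. - l (- n) v" "\<lambda>n. y (- n)" "\<lambda>n v. - m (- n) v"
    by (rule mirror_witt)
  consider "1 \<le> n" | "n = 0" | "1 \<le> - n" by linarith
  then show ?thesis
  proof cases
    case 1
    show ?thesis by (rule l_positive_closed[OF W(1) _ 1 w]) (use W(2) in blast)
  next
    case 2
    have "2 *s l 0 w = l (-1) (l 1 w) - l 1 (l (-1) w)"
      using l_l[of "-1" 1 w] by simp
    also have "\<dots> \<in> W"
      using W w by (intro subspace_diff) auto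
    finally have "(1 / 2) *s 2 *s l 0 w \<in> W"
      by (rule subspace_scale[OF W(1)])
    then show ?thesis using 2 by simp
  next
    case 3
    have "- l (- (- n)) w \<in> W"
      by (rule mir.l_positive_closed[OF W(1) _ 3 w]) (use W in \<open>auto intro: subspace_neg\<close>)
    then show ?thesis using subspace_neg[OF W(1)] by fastforce
  qed
qed

text \<open>The ladder from \<open>b\<close> occupies positive weights and its reflection from
  \<open>d\<close> negative ones. Together they span a nonzero submodule, hence everything, and
  nothing is left at weight 0.\<close>

lemma ladders_generate:
  assumes b: "b \<in> E 1" "b \<noteq> 0" "l (-1) b = 0" and d: "d = l (-2) b" "l 1 d = 0" "l 2 d = - b"
  shows "E 0 = {0}"
proof -
  interpret mir: witt_rep scale "\<lambda>n v. - l (- n) v" "\<lambda>n. y (- n)" "\<lambda>n v. - m (- n) v"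
    by (rule mirror_witt)
  obtain R where R: "b \<in> R" "\<And>r. r \<in> R \<Longrightarrow> \<exists>n>0. r \<in> E (of_nat n)"
    "\<And>r. r \<in> R \<Longrightarrow> l 1 r \<in> span R \<and> l (-1) r \<in> span R \<and> l 2 r \<in> span R"
    "\<And>r. r \<in> R \<Longrightarrow> l (-2) r \<in> span (insert d R)"
    using ladder[OF b(1,3) d] by blast
  have dE: "d \<in> E (- 1)"
    unfolding d(1) by (rule l_E[OF b(1)]) simp
  \<comment> \<open>Under reflection the relations \<open>d = l (-2) b\<close> and
    \<open>l 2 d = - b\<close> change places, so \<open>d\<close> and \<open>b\<close> exchange
    their roles.\<close>
  obtain R' where R': "d \<in> R'" "\<And>r. r \<in> R' \<Longrightarrow> \<exists>n>0. r \<in> mir.E (of_nat n)"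
    "\<And>r. r \<in> R' \<Longrightarrow> - l (- 1) r \<in> span R' \<and> - l (- (- 1)) r \<in> span R' \<and> - l (- 2) r \<in> span R'"
    "\<And>r. r \<in> R' \<Longrightarrow> - l (- (- 2)) r \<in> span (insert b R')"
  proof (rule mir.ladder[of d b])
    show "d \<in> mir.E 1" using dE mirror_E[of 1] by simp
  qed (use b d in \<open>auto simp: l_lin\<close>)
  let ?S = "R \<union> R'"
  have sub: "span R \<subseteq> span ?S" "span R' \<subseteq> span ?S" "span (insert d R) \<subseteq> span ?S"
    "span (insert b R') \<subseteq> span ?S"
    using R(1) R'(1) by (auto intro!: span_mono)
  have neg: "u \<in> span ?S" if "- u \<in> span ?S" for u
    using span_neg[OF that] by simp
  have cl: "l 1 r \<in> span ?S \<and> l 2 r \<in> span ?S \<and> l (-1) r \<in> span ?S \<and> l (-2) r \<in> span ?S"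
    if "r \<in> ?S" for r
    using that
  proof
    assume "r \<in> R"
    then show ?thesis using R(3,4) sub by blast
  next
    assume "r \<in> R'"
    from R'(3,4)[OF this] show ?thesis using sub neg by auto
  qed
  have U: "span ?S = UNIV"
  proof (rule span_eq_UNIV)
    show "b \<in> ?S" "b \<noteq> 0" using R(1) b(2) by auto
    fix n w assume "w \<in> ?S"
    have "l n w \<in> span ?S"
    proof (rule l_closed[OF subspace_span])
      show "w \<in> span ?S" using \<open>w \<in> ?S\<close> by (rule span_base)
      show "l 1 u \<in> span ?S \<and> l 2 u \<in> span ?S \<and> l (-1) u \<in> span ?S \<and> l (-2) u \<in> span ?S"
        if u: "u \<in> span ?S" for u
        by (intro conjI span_image_closed[OF lin_l _ u]) (use cl in blast)+
    qed
    then show "l n w \<in> span ?S \<and> y n w \<in> span ?S \<and> m n w \<in> span ?S"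
      by (simp add: y_zero m_zero span_zero)
  qed
  have S: "\<exists>c. c \<noteq> 0 \<and> r \<in> E c" if "r \<in> ?S" for r
    using that
  proof
    assume "r \<in> R"
    then obtain n where "n > 0" "r \<in> E (of_nat n)" using R(2) by blast
    then show ?thesis by (intro exI[of _ "of_nat n"]) simp
  next
    assume "r \<in> R'"
    then obtain n where "n > 0" "r \<in> mir.E (of_nat n)" using R'(2) by blast
    then show ?thesis using mirror_E[of "of_nat n"] by (intro exI[of _ "- of_nat n"]) simp
  qed
  have "E 0 = span (?S \<inter> E 0)"
    by (rule eigenspace_span[OF lin_l _ U]) (use S in blast)
  moreover have "?S \<inter> E 0 \<subseteq> {0}"
  proof
    fix r assume r: "r \<in> ?S \<inter> E 0"
    then obtain c where c: "c \<noteq> 0" "r \<in> E c" using S by blast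
    show "r \<in> {0}"
      using eigenspace_unique[OF c(2), of 0] r c(1) by auto
  qed
  ultimately show ?thesis
    using span_mono[of "?S \<inter> E 0" "{0}"] subspace_0[OF subspace_E[of 0]] by auto
qed

section \<open>Passage of finite dimension to the next weight\<close>

lemma fd_next:
  assumes fin: "fd (E s)" and nz: "E s \<noteq> {0}"
  shows "fd (E (s + 1))"
proof (rule ccontr)
  assume inf: "\<not> fd (E (s + 1))"
  interpret mir: witt_rep scale "\<lambda>n v. - l (- n) v" "\<lambda>n. y (- n)" "\<lambda>n v. - m (- n) v"
    by (rule mirror_witt)
  define f1 where "f1 = l (-1)"
  define f2 where "f2 v = l 1 (l (-2) v)" for v
  define f3 where "f3 v = l (-1) (l 2 (l (-2) v))" for v
  define f4 where "f4 v = l 1 (l (-2) (l 2 (l (-2) v)))" for v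
  have lin: "lin f1" "lin f2" "lin f3" "lin f4"
    unfolding f1_def f2_def f3_def f4_def by (intro linI; simp add: l_lin)+
  have img: "f1 v \<in> E s \<and> f2 v \<in> E s \<and> f3 v \<in> E s \<and> f4 v \<in> E s" if v: "v \<in> E (s + 1)" for v
  proof -
    have v2: "l (-2) v \<in> E (s - 1)" by (rule l_E[OF v]) simp
    have v3: "l 2 (l (-2) v) \<in> E (s + 1)" by (rule l_E[OF v2]) simp
    have v4: "l (-2) (l 2 (l (-2) v)) \<in> E (s - 1)" by (rule l_E[OF v3]) simp
    show ?thesis
      unfolding f1_def f2_def f3_def f4_def
      using l_E[OF v, of s "-1"] l_E[OF v2, of s 1] l_E[OF v3, of s "-1"] l_E[OF v4, of s 1] by simp
  qed
  obtain b where b: "b \<in> E (s + 1)" "b \<noteq> 0" and b0: "\<And>f. f \<in> {f1, f2, f3, f4} \<Longrightarrow> f b = 0"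
  proof (rule common_kernel[OF _ subspace_E inf, of "{f1, f2, f3, f4}"])
    show "lin f \<and> (\<exists>Z. fd Z \<and> f ` E (s + 1) \<subseteq> Z)" if f: "f \<in> {f1, f2, f3, f4}" for f
    proof -
      have "f ` E (s + 1) \<subseteq> E s" using f img by auto
      then show ?thesis using f lin fin by auto
    qed
  qed auto
  define d where "d = l (-2) b"
  have rel: "l (-1) b = 0" "l 1 d = 0" "l (-1) (l 2 d) = 0" "l 1 (l (-2) (l 2 d)) = 0"
    using b0[of f1] b0[of f2] b0[of f3] b0[of f4] by (simp_all add: d_def f1_def f2_def f3_def f4_def)
  note R = lowest_relations[OF b rel(1) d_def rel(2-4)]
  have dE: "d \<in> E (s - 1)"
    unfolding d_def by (rule l_E[OF b(1)]) simp
  \<comment> \<open>At \<open>s = - 3 / 2\<close> the left side of the first relation vanishes,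
    while its right side is \<open>- 9\<close> times \<open>b\<close>.\<close>
  have s4: "4 * s + 6 \<noteq> 0"
  proof
    assume s: "4 * s + 6 = 0"
    have "s = (4 * s + 6) / 4 - 3 / 2" by (simp add: field_simps)
    with s have "s = - 3 / 2" by simp
    then show False using R(1) b(2) by simp
  qed
  \<comment> \<open>The reflected relations for \<open>d\<close> require one more vanishing
    condition. It follows from the third one for \<open>b\<close>, because \<open>l 2 d\<close> is a
    multiple of \<open>b\<close>.\<close>
  have "(4 * s + 6) *s l (-1) (l 2 (l (-2) (l 2 d))) = l (-1) (l 2 (l (-2) ((4 * s + 6) *s l 2 d)))"
    by (simp add: l_lin)
  also have "\<dots> = 0"
    unfolding R(1) using rel(3) by (simp add: l_lin d_def)
  finally have r5: "l (-1) (l 2 (l (-2) (l 2 d))) = 0"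
    using s4 by simp
  \<comment> \<open>In the reflected module \<open>d\<close> takes the place of \<open>b\<close> at
    weight \<open>- s + 1\<close>, so the cubic also holds at \<open>- s\<close>.\<close>
  have "- s * (8 * (- s)\<^sup>2 + 17 * - s + 8) = 0"
  proof (rule mir.lowest_relations(3)[of d _ "- l 2 d"])
    show "d \<in> mir.E (- s + 1)" using dE mirror_E[of "- s + 1"] by simp
  qed (use R(4) rel r5 in \<open>simp_all add: l_lin\<close>)
  then have "s = 0 \<or> 8 * s\<^sup>2 - 17 * s + 8 = 0" by simp
  moreover have "s = 0 \<or> 8 * s\<^sup>2 + 17 * s + 8 = 0" using R(3) by simp
  \<comment> \<open>A nonzero \<open>s\<close> would be a root of both quadratics, although they
    differ by \<open>34 * s\<close>.\<close>
  ultimately have s: "s = 0"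
    by (auto simp: algebra_simps) algebra
  have "l 2 d = - b"
  proof -
    have "6 *s l 2 d = 6 *s (- b)" using R(1) s by simp
    then show ?thesis by (simp only: scale_cancel_left) simp
  qed
  then have "E 0 = {0}"
    using b s rel by (intro ladders_generate[of b d]) (simp_all add: d_def)
  then show False using nz s by simp
qed

end

section \<open>Irreducible weight modules\<close>

lemma int_switch:
  fixes a b :: int
  assumes "P a" "\<not> P b" "a \<le> b"
  shows "\<exists>p. a \<le> p \<and> p < b \<and> P p \<and> \<not> P (p + 1)"
proof (rule ccontr)
  assume no: "\<not> ?thesis"
  have "k \<le> b \<longrightarrow> P k" if "a \<le> k" for k
    using that by (induction k rule: int_ge_induct) (use assms(1) no in auto)
  then show False using assms(2,3) by blast
qed

context tsv_rep
begin

text \<open>The weight spaces in the coset of \<open>c\<close> modulo the integers span a nonzero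
  submodule, hence everything; a weight space outside the coset is then zero.\<close>

lemma weights_in_coset:
  assumes "E c \<noteq> {0}" "\<not> fd (E c')"
  shows "\<exists>k. c' = c + of_int k"
proof (rule ccontr)
  assume no: "\<not> ?thesis"
  let ?R = "\<Union>k. E (c + of_int k)"
  obtain v where v: "v \<in> E c" "v \<noteq> 0"
    using assms(1) subspace_0[OF subspace_E[of c]] by blast
  have U: "span ?R = UNIV"
  proof (rule span_eq_UNIV)
    show "v \<in> ?R" using v(1) by (intro UN_I[of 0]) simp_all
    show "v \<noteq> 0" by fact
    fix n w assume "w \<in> ?R"
    then obtain k where k: "w \<in> E (c + of_int k)" by blast
    have "l n w \<in> E (c + of_int (k + n))" "y n w \<in> E (c + of_int (k + n))"
      "m n w \<in> E (c + of_int (k + n))"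
      by (rule l_E[OF k] y_E[OF k] m_E[OF k], simp add: add.assoc)+
    then show "l n w \<in> span ?R \<and> y n w \<in> span ?R \<and> m n w \<in> span ?R"
      by (intro conjI span_base UN_I[of "k + n"]) simp_all
  qed
  have "E c' = span (?R \<inter> E c')"
    by (rule eigenspace_span[OF lin_l _ U]) blast
  moreover have "?R \<inter> E c' \<subseteq> {0}"
  proof
    fix r assume r: "r \<in> ?R \<inter> E c'"
    then obtain k where k: "r \<in> E (c + of_int k)" by blast
    show "r \<in> {0}"
      using eigenspace_unique[OF k, of c'] r no by auto
  qed
  ultimately have "fd (E c')"
    unfolding fd_def using finite_subset[of "?R \<inter> E c'" "{0}"] by (intro exI[of _ "?R \<inter> E c'"]) simp
  then show False using assms(2) by simp
qed

lemma y_m_trivial':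
  assumes inf: "\<not> fd (E (c + 1))" and fin: "fd (E c)"
  shows "y n v = 0" "m n v = 0"
proof -
  interpret mir: tsv_rep scale "\<lambda>n v. - l (- n) v" "\<lambda>n. y (- n)" "\<lambda>n v. - m (- n) v"
    by (rule mirror)
  have "\<not> fd (mir.E (- c - 1))" "fd (mir.E (- c - 1 + 1))"
    using inf fin mirror_E[of "- c - 1"] mirror_E[of "- c"] by (simp_all add: add.commute)
  from mir.y_m_trivial[OF this, of "- n" v] show "y n v = 0" "m n v = 0" by simp_all
qed

theorem finite_weight_spaces:
  assumes fin: "fd (E c)" and nz: "E c \<noteq> {0}"
  shows "fd (E c')"
proof (rule ccontr)
  assume inf: "\<not> fd (E c')"
  define P where "P k = fd (E (c + of_int k))" for k
  obtain k where "c' = c + of_int k"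
    using weights_in_coset[OF nz inf] by blast
  then have k: "\<not> P k" using inf by (simp add: P_def)
  have P0: "P 0" using fin by (simp add: P_def)
  \<comment> \<open>Between the weights \<open>c\<close> and \<open>c'\<close> some
    finite-dimensional space is adjacent to an infinite-dimensional one, on whichever side
    \<open>c'\<close> lies.\<close>
  have y_m_zero: "y n v = 0 \<and> m n v = 0" for n v
  proof (cases "0 \<le> k")
    case True
    obtain p where "P p" "\<not> P (p + 1)"
      using int_switch[of P, OF P0 k True] by blast
    then show ?thesis
      using y_m_trivial'[of "c + of_int p"] by (simp add: P_def add.assoc)
  next
    case False
    obtain p where "\<not> P p" "P (p + 1)"
      using int_switch[of "\<lambda>p. \<not> P p", OF k _ ] P0 False by fastforce
    then show ?thesis
      using y_m_trivial[of "c + of_int p"] by (simp add: P_def add.assoc)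
  qed
  interpret W: witt_rep scale l y m
    by unfold_locales (use y_m_zero inf in auto)
  interpret mir: witt_rep scale "\<lambda>n v. - l (- n) v" "\<lambda>n. y (- n)" "\<lambda>n v. - m (- n) v"
    by (rule W.mirror_witt)
  have P1: "P 1" using W.fd_next[OF fin nz] by (simp add: P_def)
  have "k \<noteq> 0" using k P0 by metis
  then consider "1 \<le> k" | "k < 0" by linarith
  then show False
  proof cases
    case 1
    \<comment> \<open>The search starts at 1, so that \<open>c + p\<close> and \<open>c\<close> lie
      at distances 1 and \<open>p + 1\<close> \<ge> 2 below the infinite-dimensional weight
      space.\<close>
    obtain p where p: "1 \<le> p" "P p" "\<not> P (p + 1)"
      using int_switch[of P, OF P1 k 1] by blast
    show False
    proof (rule mir.two_finite[of "- (c + of_int (p + 1))" "p + 1"])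
      have mE: "mir.E x = E z" if "z = - x" for x z
        using mirror_E[of x] that by simp
      show "\<not> fd (mir.E (- (c + of_int (p + 1))))"
        by (subst mE[of "c + of_int (p + 1)"]) (use p(3) in \<open>simp_all add: P_def\<close>)
      show "fd (mir.E (- (c + of_int (p + 1)) + 1))"
        by (subst mE[of "c + of_int p"]) (use p(2) in \<open>simp_all add: P_def\<close>)
      show "fd (mir.E (- (c + of_int (p + 1)) + of_int (p + 1)))"
        by (subst mE[of c]) (use fin in simp_all)
    qed (use p(1) in simp)
  next
    case 2
    obtain p where p: "p < 0" "\<not> P p" "P (p + 1)"
      using int_switch[of "\<lambda>p. \<not> P p", OF k _ ] P0 2 by fastforce
    \<comment> \<open>The second finite weight is \<open>c + 1\<close> rather than \<open>c\<close>,
      so that the distance \<open>1 - p\<close> is at least 2 even when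
      \<open>p = - 1\<close>.\<close>
    show False
    proof (rule W.two_finite[of "c + of_int p" "1 - p"])
      show "fd (E (c + of_int p + of_int (1 - p)))"
        using P1 by (simp add: P_def)
    qed (use p in \<open>simp_all add: P_def add.assoc\<close>)
  qed
qed

end

section \<open>From the Lie algebra module to its operators\<close>

lemma (in tsv_module) irreducible_weight_tsv_rep:
  assumes irr: "irreducible" and weight: "weight_module"
  shows "tsv_rep vscale (\<lambda>n. act (basis_vec (L n))) (\<lambda>n. act (basis_vec (Y n)))
    (\<lambda>n. act (basis_vec (M n)))"
proof -
  interpret left: module_hom tsv_scale vscale "\<lambda>x. act x v" for v
    using act_linear_left[of v] by (simp add: Vector_Spaces.linear_def)
  interpret right: module_hom vscale vscale "act x" for x
    using act_linear_right[of x] by (simp add: Vector_Spaces.linear_def)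
  have rel: "act (basis_vec a) (act (basis_vec b) v)
      = act (basis_vec b) (act (basis_vec a) v) + act (basis_bracket a b) v" for a b v
    using act_bracket[of "basis_vec a" "basis_vec b" v] by (simp add: tsv_bracket_basis)
  have sub: "submodule W" if W: "V.subspace W" and cl: "\<And>a w. w \<in> W \<Longrightarrow> act (basis_vec a) w \<in> W" for W
  proof -
    have "act x w \<in> W" if w: "w \<in> W" for x w
    proof -
      have "act x w = (\<Sum>b\<in>Poly_Mapping.keys x.
          vscale (Poly_Mapping.lookup x b) (act (basis_vec b) w))"
        by (subst tsv_expand) (simp only: left.sum left.scale)
      also have "\<dots> \<in> W"
        using cl[OF w] by (intro V.subspace_sum[OF W] V.subspace_scale[OF W])
      finally show ?thesis .
    qed
    then show ?thesis using W by (simp add: submodule_def)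
  qed
  have m0: "\<exists>c. \<forall>v. act (basis_vec (M 0)) v = vscale c v"
  proof -
    obtain B where B: "V.independent B" "V.span B = UNIV"
      "\<And>b h. b \<in> B \<Longrightarrow> h \<in> tsv_cartan \<Longrightarrow> \<exists>c. act h b = vscale c b"
      using weight unfolding weight_module_def acts_diagonalizably_def by blast
    have "B \<noteq> {}"
    proof
      assume "B = {}"
      then have "(UNIV :: 'v set) = {0}" using B(2) by simp
      then show False using irr by (simp add: irreducible_def)
    qed
    then obtain b where b: "b \<in> B" by blast
    have "b \<noteq> 0" using B(1) b V.dependent_zero by blast
    have "basis_vec (M 0) \<in> tsv_cartan"
      unfolding tsv_cartan_def by (intro tsv.span_base) simp
    then obtain c where c: "act (basis_vec (M 0)) b = vscale c b"
      using B(3)[OF b] by blast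
    \<comment> \<open>\<open>M 0\<close> is central, so its eigenspace is a submodule, and it
      contains \<open>b\<close> \<noteq> 0. This is Schur's lemma with the eigenvalue supplied by
      diagonalizability.\<close>
    let ?W = "{v. act (basis_vec (M 0)) v = vscale c v}"
    have "basis_bracket (M 0) a = 0" for a
      by (cases a) auto
    then have comm: "act (basis_vec (M 0)) (act (basis_vec a) v)
        = act (basis_vec a) (act (basis_vec (M 0)) v)" for a v
      by (simp add: rel[of "M 0" a] left.zero)
    have "submodule ?W"
    proof (rule sub)
      show "V.subspace ?W"
        by (auto simp: V.subspace_def right.add right.scale right.zero V.scale_right_distrib
            mult.commute)
      show "act (basis_vec a) w \<in> ?W" if "w \<in> ?W" for a w
        using that by (simp add: comm right.scale)
    qed
    then have "?W = UNIV"
      using irr c \<open>b \<noteq> 0\<close> unfolding irreducible_def by blast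
    then show ?thesis by blast
  qed
  show ?thesis
  proof unfold_locales
    fix W :: "'v set"
    assume W: "V.subspace W" and cl: "\<And>n w. w \<in> W \<Longrightarrow> act (basis_vec (L n)) w \<in> W
      \<and> act (basis_vec (Y n)) w \<in> W \<and> act (basis_vec (M n)) w \<in> W"
    have "act (basis_vec a) w \<in> W" if "w \<in> W" for a w
      using cl[OF that] by (cases a) auto
    then show "W = {0} \<or> W = UNIV"
      using sub[OF W] irr unfolding irreducible_def by blast
  next
    fix n p v
    show "act (basis_vec (L n)) (act (basis_vec (L p)) v) = act (basis_vec (L p)) (act (basis_vec (L n)) v)
        + vscale (of_int (p - n)) (act (basis_vec (L (n + p))) v)"
      by (subst rel) (simp add: left.scale)
    show "act (basis_vec (L n)) (act (basis_vec (Y p)) v) = act (basis_vec (Y p)) (act (basis_vec (L n)) v)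
        + vscale (of_int p - of_int n / 2) (act (basis_vec (Y (n + p))) v)"
      by (subst rel) (simp add: left.scale)
    show "act (basis_vec (L n)) (act (basis_vec (M p)) v) = act (basis_vec (M p)) (act (basis_vec (L n)) v)
        + vscale (of_int p) (act (basis_vec (M (n + p))) v)"
      by (subst rel) (simp add: left.scale)
    show "act (basis_vec (Y n)) (act (basis_vec (Y p)) v) = act (basis_vec (Y p)) (act (basis_vec (Y n)) v)
        + vscale (of_int (p - n)) (act (basis_vec (M (n + p))) v)"
      by (subst rel) (simp add: left.scale)
    show "act (basis_vec (Y n)) (act (basis_vec (M p)) v) = act (basis_vec (M p)) (act (basis_vec (Y n)) v)"
      by (subst rel) (simp add: left.zero)
    show "act (basis_vec (M n)) (act (basis_vec (M p)) v) = act (basis_vec (M p)) (act (basis_vec (M n)) v)"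
      by (subst rel) (simp add: left.zero)
    show "\<exists>c. \<forall>v. act (basis_vec (M 0)) v = vscale c v"
      by (rule m0)
  qed
qed

theorem corollary1p4:
  fixes vscale :: "complex \<Rightarrow> 'v::ab_group_add \<Rightarrow> 'v" and act :: "tsv \<Rightarrow> 'v \<Rightarrow> 'v"
  assumes "tsv_module vscale act"
    and "lie_module.irreducible vscale act"
    and "tsv_module.weight_module vscale act"
    and "\<exists>\<mu>. 0 < vector_space.dim vscale (tsv_module.weight_space vscale act \<mu>)
      \<and> lie_module.finite_dimensional vscale (tsv_module.weight_space vscale act \<mu>)"
  shows "tsv_module.Harish_Chandra vscale act"
proof -
  interpret tsv_module vscale act by fact
  interpret rep: tsv_rep vscale "\<lambda>n. act (basis_vec (L n))" "\<lambda>n. act (basis_vec (Y n))"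
      "\<lambda>n. act (basis_vec (M n))"
    using assms(2,3) by (rule irreducible_weight_tsv_rep)
  have ws: "weight_space \<mu> = rep.E \<mu>" for \<mu>
    by (simp add: weight_space_def rep.eigenspace_def)
  have fd: "finite_dimensional W = rep.fd W" for W
    by (simp add: finite_dimensional_def rep.fd_def)
  obtain \<mu> where \<mu>: "0 < V.dim (rep.E \<mu>)" "rep.fd (rep.E \<mu>)"
    using assms(4) by (auto simp: ws fd)
  have "rep.E \<mu> \<noteq> {0}"
  proof
    assume "rep.E \<mu> = {0}"
    then have "V.dim (rep.E \<mu>) = 0"
      using V.dim_eq_card[of "{}" "{0}"] V.independent_empty by simp
    then show False using \<mu>(1) by simp
  qed
  then show ?thesis
    unfolding Harish_Chandra_def ws fd
    using assms(2,3) rep.finite_weight_spaces[OF \<mu>(2)] by blast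
qed

end
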